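(* Let $G$ be a finite group and $H \le G$ a subgroup. Let $w$ be an irreducible weight on $G$ and let $\alpha$ be a probability distribution on $G$, both regarded as elements of $\mathbb{C}[G]$. Let $(X_t)_{t\ge 0}$ denote the Markov chain $\mathrm{MC}(\alpha,w)$. Then $\mathrm{MC}(\alpha,w)$ lumps weakly to $G/H$ if and only if there exists an idempotent $e \in E^\bullet(H)$ such that (i) $\alpha \in \mathbb{C}[G]e$, (ii) $e w (1-e) = 0$, (iii) $(e-\eta_H) w \eta_H = 0$. In this case (that is, for any such $e$), for any $t \ge 0$, the conditional distribution of $X_t$ given the sequence of cosets $X_0H, \ldots, X_tH$ always belongs to $\mathbb{C}[G]e$.
   Context: A weight on $G$ is a function $w : G \to \mathbb{R}_{\ge 0}$ that is not identically zero; for $K \subseteq G$ write $w(K) = \sum_{g\in K} w(g)$. Functions $x: G \to \mathbb{C}$ are identified with elements $\sum_{g} x(g) g$ of $\mathbb{C}[G]$; a probability distribution is a weight of total mass $1$. The weight $w$ is irreducible if its support generates $G$. $\mathrm{MC}(\alpha,w)$ denotes the left-invariant random walk: the time-homogeneous Markov chain $(X_t)_{t\ge 0}$ on $G$ with $X_0$ distributed as $\alpha$ and $\mathbb{P}[X_{t+1} = xg \mid X_t = x] = w(g)/w(G)$. It lumps weakly to $G/H$ if the process $(X_tH)_{t \ge 0}$ on the set $G/H$ of left cosets is a time-homogeneous Markov chain. For a non-empty $K \subseteq G$, $\eta_K = |K|^{-1}\sum_{g\in K} g \in \mathbb{C}[G]$. $E^\bullet(H)$ is the set of idempotents $e \in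 \mathbb{C}[H]$ with $\eta_H e = \eta_H$. Conditional distributions are taken given sequences of cosets of positive probability. *)

theory Defs
  imports "HOL-Algebra.Generated_Groups" "HOL-Algebra.Left_Coset" "HOL-Algebra.Ideal" "HOL-Probability.Probability"
begin

text \<open>Elements are extensional functions on the carrier, the function \<open>x\<close> standing for the formal
  sum of the \<open>x(g) g\<close>. The coefficient of \<open>g\<close> in a product is the sum of \<open>x(h) y(k)\<close> over all
  \<open>h k = g\<close>, written here with \<open>k = h\<^sup>-\<^sup>1 g\<close>.\<close>

definition group_algebra :: "('a, 'm) monoid_scheme \<Rightarrow> ('a \<Rightarrow> complex) ring" where
  "group_algebra G =
     \<lparr>carrier = carrier G \<rightarrow>\<^sub>E UNIV,
      monoid.mult = (\<lambda>x y. \<lambda>g\<in>carrier G. \<Sum>h\<in>carrier G. x h * y (inv\<^bsub>G\<^esub> h \<otimes>\<^bsub>G\<^esub> g)),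
      one = (\<lambda>g\<in>carrier G. if g = \<one>\<^bsub>G\<^esub> then 1 else 0),
      zero = (\<lambda>g\<in>carrier G. 0),
      add = (\<lambda>x y. \<lambda>g\<in>carrier G. x g + y g)\<rparr>"

definition galg_of :: "('a, 'm) monoid_scheme \<Rightarrow> ('a \<Rightarrow> real) \<Rightarrow> 'a \<Rightarrow> complex" where
  "galg_of G f = (\<lambda>g\<in>carrier G. complex_of_real (f g))"

text \<open>The algebra of a subgroup is identified with the set of elements of the big group algebra
  that are supported on the subgroup.\<close>

definition galg_sub :: "('a, 'm) monoid_scheme \<Rightarrow> 'a set \<Rightarrow> ('a \<Rightarrow> complex) set" where
  "galg_sub G H = {x \<in> carrier (group_algebra G). \<forall>g \<in> carrier G - H. x g = 0}"

definition eta :: "('a, 'm) monoid_scheme \<Rightarrow> 'a set \<Rightarrow> 'a \<Rightarrow> complex" where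
  "eta G K = (\<lambda>g\<in>carrier G. if g \<in> K then 1 / of_nat (card K) else 0)"

definition E_bullet :: "('a, 'm) monoid_scheme \<Rightarrow> 'a set \<Rightarrow> ('a \<Rightarrow> complex) set" where
  "E_bullet G H =
     {e \<in> galg_sub G H. e \<otimes>\<^bsub>group_algebra G\<^esub> e = e \<and>
                        eta G H \<otimes>\<^bsub>group_algebra G\<^esub> e = eta G H}"

text \<open>The principal left ideal generated by \<open>e\<close> is the
  library's \<open>cgenideal\<close>, written \<open>PIdl e\<close>: its definition as the set of all \<open>x e\<close> is the left ideal
  also when the ring is not commutative.\<close>

definition weight :: "('a, 'm) monoid_scheme \<Rightarrow> ('a \<Rightarrow> real) \<Rightarrow> bool" where
  "weight G w \<longleftrightarrow> (\<forall>g\<in>carrier G. 0 \<le> w g) \<and> (\<exists>g\<in>carrier G. w g \<noteq> 0)"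

definition prob_distribution :: "('a, 'm) monoid_scheme \<Rightarrow> ('a \<Rightarrow> real) \<Rightarrow> bool" where
  "prob_distribution G \<alpha> \<longleftrightarrow> weight G \<alpha> \<and> sum \<alpha> (carrier G) = 1"

definition irreducible_weight :: "('a, 'm) monoid_scheme \<Rightarrow> ('a \<Rightarrow> real) \<Rightarrow> bool" where
  "irreducible_weight G w \<longleftrightarrow>
     weight G w \<and> generate G {g \<in> carrier G. w g \<noteq> 0} = carrier G"

definition stochastic_matrix :: "'s set \<Rightarrow> ('s \<Rightarrow> 's \<Rightarrow> real) \<Rightarrow> bool" where
  "stochastic_matrix S P \<longleftrightarrow> (\<forall>x\<in>S. (\<forall>y\<in>S. 0 \<le> P x y) \<and> (\<Sum>y\<in>S. P x y) = 1)"

text \<open>Time-homogeneous Markov chain on a finite state space \<open>S\<close> with transition matrix \<open>P\<close>;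
  the rows of \<open>P\<close> at states that are never visited are not determined by the process.\<close>

definition markov_chain ::
  "'b measure \<Rightarrow> 's set \<Rightarrow> ('s \<Rightarrow> 's \<Rightarrow> real) \<Rightarrow> (nat \<Rightarrow> 'b \<Rightarrow> 's) \<Rightarrow> bool" where
  "markov_chain M S P Y \<longleftrightarrow>
     prob_space M \<and> finite S \<and> stochastic_matrix S P \<and>
     (\<forall>t. Y t \<in> measurable M (count_space S)) \<and>
     (\<forall>t s. (\<forall>i \<le> Suc t. s i \<in> S) \<and> \<P>(\<omega> in M. \<forall>i\<le>t. Y i \<omega> = s i) > 0 \<longrightarrow>
        \<P>(\<omega> in M. Y (Suc t) \<omega> = s (Suc t) \<bar> \<forall>i\<le>t. Y i \<omega> = s i) = P (s t) (s (Suc t)))"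

text \<open>\<open>X\<close> is a realization of the left-invariant random walk with initial distribution \<open>\<alpha>\<close>:
  the step from \<open>x\<close> to \<open>y = x g\<close> has probability \<open>w(g) / w(G)\<close> with \<open>g = x\<^sup>-\<^sup>1 y\<close>.\<close>

definition is_MC ::
  "('a, 'm) monoid_scheme \<Rightarrow> ('a \<Rightarrow> real) \<Rightarrow> ('a \<Rightarrow> real) \<Rightarrow> 'b measure \<Rightarrow> (nat \<Rightarrow> 'b \<Rightarrow> 'a) \<Rightarrow> bool"
where
  "is_MC G \<alpha> w M X \<longleftrightarrow>
     markov_chain M (carrier G) (\<lambda>x y. w (inv\<^bsub>G\<^esub> x \<otimes>\<^bsub>G\<^esub> y) / sum w (carrier G)) X \<and>
     (\<forall>g\<in>carrier G. \<P>(\<omega> in M. X 0 \<omega> = g) = \<alpha> g)"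

definition lumps_weakly ::
  "('a, 'm) monoid_scheme \<Rightarrow> 'a set \<Rightarrow> 'b measure \<Rightarrow> (nat \<Rightarrow> 'b \<Rightarrow> 'a) \<Rightarrow> bool" where
  "lumps_weakly G H M X \<longleftrightarrow>
     (\<exists>P. markov_chain M (lcosets\<^bsub>G\<^esub> H) P (\<lambda>t \<omega>. X t \<omega> <#\<^bsub>G\<^esub> H))"

definition cond_dist ::
  "('a, 'm) monoid_scheme \<Rightarrow> 'a set \<Rightarrow> 'b measure \<Rightarrow> (nat \<Rightarrow> 'b \<Rightarrow> 'a) \<Rightarrow> nat \<Rightarrow> (nat \<Rightarrow> 'a set)
     \<Rightarrow> 'a \<Rightarrow> real" where
  "cond_dist G H M X t c =
     (\<lambda>g. \<P>(\<omega> in M. X t \<omega> = g \<bar> \<forall>i\<le>t. X i \<omega> <#\<^bsub>G\<^esub> H = c i))"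

lemma group_algebra_simps:
  "carrier (group_algebra G) = carrier G \<rightarrow>\<^sub>E UNIV"
  "x \<otimes>\<^bsub>group_algebra G\<^esub> y =
     (\<lambda>g\<in>carrier G. \<Sum>h\<in>carrier G. x h * y (inv\<^bsub>G\<^esub> h \<otimes>\<^bsub>G\<^esub> g))"
  "\<one>\<^bsub>group_algebra G\<^esub> = (\<lambda>g\<in>carrier G. if g = \<one>\<^bsub>G\<^esub> then 1 else 0)"
  "\<zero>\<^bsub>group_algebra G\<^esub> = (\<lambda>g\<in>carrier G. 0)"
  "x \<oplus>\<^bsub>group_algebra G\<^esub> y = (\<lambda>g\<in>carrier G. x g + y g)"
  by (simp_all add: group_algebra_def)

lemma galg_eqI:
  assumes "x \<in> carrier G \<rightarrow>\<^sub>E UNIV" "y \<in> carrier G \<rightarrow>\<^sub>E UNIV" "\<And>g. g \<in> carrier G \<Longrightarrow> x g = y g"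
  shows "x = y"
  using assms by (rule PiE_ext)

lemma (in group) group_algebra_monoid:
  assumes fin: "finite (carrier G)"
  shows "monoid (group_algebra G)"
proof (rule monoidI)
  fix x y z
  assume "x \<in> carrier (group_algebra G)" "y \<in> carrier (group_algebra G)"
    "z \<in> carrier (group_algebra G)"
  let ?A = "group_algebra G"
  show "(x \<otimes>\<^bsub>?A\<^esub> y) \<otimes>\<^bsub>?A\<^esub> z = x \<otimes>\<^bsub>?A\<^esub> (y \<otimes>\<^bsub>?A\<^esub> z)"
  proof (rule galg_eqI[of _ G])
    fix g assume g: "g \<in> carrier G"
    have cancel: "inv k \<otimes> (k \<otimes> h) = h" "k \<otimes> (inv k \<otimes> h) = h"
        "inv (inv k \<otimes> h) \<otimes> (inv k \<otimes> g) = inv h \<otimes> g"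
      if "k \<in> carrier G" "h \<in> carrier G" for k h
    proof -
      show c: "inv k \<otimes> (k \<otimes> h) = h" "k \<otimes> (inv k \<otimes> h) = h"
        using that g by (simp_all add: m_assoc[symmetric])
      have "inv (inv k \<otimes> h) \<otimes> (inv k \<otimes> g) = inv h \<otimes> (k \<otimes> (inv k \<otimes> g))"
        using that g by (simp add: inv_mult_group m_assoc)
      then show "inv (inv k \<otimes> h) \<otimes> (inv k \<otimes> g) = inv h \<otimes> g"
        using that g by (simp add: m_assoc[symmetric])
    qed
    have shift: "(\<Sum>h\<in>carrier G. y (inv k \<otimes> h) * z (inv h \<otimes> g)) =
        (\<Sum>h\<in>carrier G. y h * z (inv h \<otimes> (inv k \<otimes> g)))" if k: "k \<in> carrier G" for k
      by (rule sum.reindex_bij_witness[of _ "\<lambda>h. k \<otimes> h" "\<lambda>h. inv k \<otimes> h"])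
        (use k g in \<open>simp_all add: cancel\<close>)
    have "((x \<otimes>\<^bsub>?A\<^esub> y) \<otimes>\<^bsub>?A\<^esub> z) g =
        (\<Sum>h\<in>carrier G. \<Sum>k\<in>carrier G. x k * (y (inv k \<otimes> h) * z (inv h \<otimes> g)))"
      using g by (simp add: group_algebra_simps sum_distrib_right mult.assoc)
    also have "\<dots> = (\<Sum>k\<in>carrier G. \<Sum>h\<in>carrier G. x k * (y (inv k \<otimes> h) * z (inv h \<otimes> g)))"
      by (rule sum.swap)
    also have "\<dots> = (\<Sum>k\<in>carrier G. x k * (\<Sum>h\<in>carrier G. y h * z (inv h \<otimes> (inv k \<otimes> g))))"
      by (intro sum.cong refl) (simp add: shift[symmetric] sum_distrib_left)
    also have "\<dots> = (x \<otimes>\<^bsub>?A\<^esub> (y \<otimes>\<^bsub>?A\<^esub> z)) g"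
      using g by (simp add: group_algebra_simps)
    finally show "((x \<otimes>\<^bsub>?A\<^esub> y) \<otimes>\<^bsub>?A\<^esub> z) g = (x \<otimes>\<^bsub>?A\<^esub> (y \<otimes>\<^bsub>?A\<^esub> z)) g" .
  qed (auto simp: group_algebra_simps)
next
  fix x assume x: "x \<in> carrier (group_algebra G)"
  let ?A = "group_algebra G"
  show "\<one>\<^bsub>?A\<^esub> \<otimes>\<^bsub>?A\<^esub> x = x"
  proof (rule galg_eqI[of _ G])
    fix g assume g: "g \<in> carrier G"
    have "(\<one>\<^bsub>?A\<^esub> \<otimes>\<^bsub>?A\<^esub> x) g =
        (\<Sum>h\<in>carrier G. if h = \<one> then x (inv h \<otimes> g) else 0)"
      using g by (auto simp: group_algebra_simps intro!: sum.cong)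
    then show "(\<one>\<^bsub>?A\<^esub> \<otimes>\<^bsub>?A\<^esub> x) g = x g"
      using g fin by (simp add: sum.delta)
  qed (use x in \<open>auto simp: group_algebra_simps\<close>)
  show "x \<otimes>\<^bsub>?A\<^esub> \<one>\<^bsub>?A\<^esub> = x"
  proof (rule galg_eqI[of _ G])
    fix g assume g: "g \<in> carrier G"
    have "inv h \<otimes> g = \<one> \<longleftrightarrow> h = g" if "h \<in> carrier G" for h
      using that g by (metis inv_closed inv_equality inv_inv l_inv)
    then have "(x \<otimes>\<^bsub>?A\<^esub> \<one>\<^bsub>?A\<^esub>) g = (\<Sum>h\<in>carrier G. if h = g then x h else 0)"
      using g by (auto simp: group_algebra_simps intro!: sum.cong)
    then show "(x \<otimes>\<^bsub>?A\<^esub> \<one>\<^bsub>?A\<^esub>) g = x g"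
      using g fin by (simp add: sum.delta)
  qed (use x in \<open>auto simp: group_algebra_simps\<close>)
qed (auto simp: group_algebra_simps)

lemma (in group) group_algebra_ring:
  assumes fin: "finite (carrier G)"
  shows "ring (group_algebra G)"
proof (rule ringI)
  show "abelian_group (group_algebra G)"
  proof (rule abelian_groupI)
    fix x assume "x \<in> carrier (group_algebra G)"
    then show "\<exists>y\<in>carrier (group_algebra G).
        y \<oplus>\<^bsub>group_algebra G\<^esub> x = \<zero>\<^bsub>group_algebra G\<^esub>"
      by (intro bexI[of _ "\<lambda>g\<in>carrier G. - x g"]) (auto simp: group_algebra_simps)
  qed (auto simp: group_algebra_simps algebra_simps PiE_def extensional_def fun_eq_iff)
  show "monoid (group_algebra G)"
    by (rule group_algebra_monoid[OF fin])
qed (auto simp: group_algebra_simps algebra_simps sum.distrib fun_eq_iff)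

end

theory Submission
  imports Defs "HOL-Algebra.Multiplicative_Group"
begin

text \<open>
  Write \<open>w\<close> and \<open>\<alpha>\<close> for the elements of \<open>\<complex>[G]\<close> and \<open>\<eta>\<close> for the average over \<open>H\<close>. For a sequence of
  cosets \<open>c\<close>, let \<open>hist t c\<close> be the element of \<open>\<complex>[G]\<close> whose coefficient at \<open>g\<close> is the probability
  that \<open>X\<^sub>t = g\<close> and that the walk has passed through \<open>c\<^sub>0, \<dots>, c\<^sub>t\<close>. It starts as the part of \<open>\<alpha>\<close>
  in \<open>c\<^sub>0\<close>, and each step multiplies it by \<open>w\<close> on the right, normalizes, and cuts down to the next
  coset.

  Multiplication by \<open>\<eta>\<close> on the right only remembers the mass of each coset. So \<open>hist t c \<cdot> w \<eta>\<close>
  lists the probabilities of the next coset jointly with the past, whereas \<open>hist t c \<cdot> \<eta> w \<eta>\<close> lists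
  what they would be if \<open>X\<^sub>t\<close> were uniform in its coset given the past. The second depends on the
  past only through \<open>c\<^sub>t\<close> and the probability of the past. If the two agree for all \<open>t\<close> and \<open>c\<close>, the
  coset process is therefore Markov. Conversely, if it is Markov, then its transition matrix has to
  be the one of the uniform distribution: the time averages of the laws of \<open>X\<^sub>t\<close> have only the
  uniform distribution as a limit, as \<open>w\<close> is irreducible, and averaging the one-step equations
  over time determines the matrix. This makes weak lumping equivalent to
  \<open>hist t c \<cdot> w \<eta> = hist t c \<cdot> \<eta> w \<eta>\<close> for all \<open>t\<close> and \<open>c\<close> (\<open>lumps_weakly_iff\<close>), a condition that
  is linear in \<open>hist t c\<close> and stable under multiplication from the left.

  Given an idempotent \<open>e\<close> as in the theorem, an induction on \<open>t\<close> shows \<open>hist t c \<cdot> e = hist t c\<close>: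
  \<open>\<alpha> e = \<alpha>\<close> starts it, \<open>e w = e w e\<close> lets it pass through a step, and cutting down to a left coset of
  \<open>H\<close> commutes with right multiplication by \<open>e \<in> \<complex>[H]\<close>. Then \<open>e w \<eta> = \<eta> w \<eta>\<close> gives the balance
  condition, and \<open>hist t c \<in> \<complex>[G]e\<close> is, up to a scalar, the last claim.

  Given weak lumping, let \<open>L\<close> be the left ideal generated by all \<open>hist t c\<close>. It is closed under right
  multiplication by \<open>w\<close> and under cutting down to cosets. The orthogonal projection \<open>e\<close> of the unit
  onto \<open>L\<close> satisfies \<open>x e = x\<close> for \<open>x \<in> L\<close>, and lies in \<open>\<complex>[H]\<close> because cutting down to \<open>H\<close> is itself an
  orthogonal projection that maps \<open>L\<close> to \<open>L\<close> (\<open>left_ideal_idempotent\<close>). Then \<open>\<alpha> \<in> L\<close>, \<open>e w \<in> L\<close> and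
  the balance condition for \<open>e \<in> L\<close> are the three conditions.
\<close>

section \<open>Projections and convergent subsequences over a finite index set\<close>

text \<open>\<open>L\<close> is a linear space of functions whose values outside \<open>S\<close> are irrelevant, so closure under linear
  combinations is only asked for up to agreement on \<open>S\<close>. That makes an induction on \<open>S\<close> possible, in
  which the members of \<open>L\<close> vanishing at one more index form the smaller space.\<close>

lemma exists_orthogonal_projection:
  fixes L :: "('i \<Rightarrow> complex) set"
  assumes "finite S" and "L \<noteq> {}"
    and "\<And>x y c. x \<in> L \<Longrightarrow> y \<in> L \<Longrightarrow> \<exists>z\<in>L. \<forall>i\<in>S. z i = x i + c * y i"
  shows "\<exists>p\<in>L. \<forall>y\<in>L. (\<Sum>i\<in>S. (d i - p i) * cnj (y i)) = 0"
  using assms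
proof (induction S arbitrary: L d rule: finite_induct)
  case empty
  then show ?case by auto
next
  case (insert s S)
  define L0 where "L0 = {x \<in> L. x s = 0}"
  obtain x0 where "x0 \<in> L" using insert.prems by blast
  then obtain z where z: "z \<in> L" "\<forall>i\<in>insert s S. z i = x0 i + (-1) * x0 i"
    using insert.prems(2)[of x0 x0 "-1"] by blast
  then have "L0 \<noteq> {}" by (auto simp: L0_def)
  have lin0: "\<exists>z\<in>L0. \<forall>i\<in>S. z i = x i + c * y i" if xy: "x \<in> L0" "y \<in> L0" for x y c
  proof -
    obtain z where "z \<in> L" "\<forall>i\<in>insert s S. z i = x i + c * y i"
      using insert.prems(2)[of x y c] xy unfolding L0_def by blast
    then show ?thesis using xy by (intro bexI[of _ z]) (auto simp: L0_def)
  qed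
  have proj0: "\<exists>p\<in>L0. \<forall>y\<in>L0. (\<Sum>i\<in>S. (d i - p i) * cnj (y i)) = 0" for d
    using insert.IH[OF \<open>L0 \<noteq> {}\<close> lin0] by blast
  show ?case
  proof (cases "L0 = L")
    case True
    then have s0: "y s = 0" if "y \<in> L" for y using that by (auto simp: L0_def)
    obtain p where "p \<in> L" "\<forall>y\<in>L. (\<Sum>i\<in>S. (d i - p i) * cnj (y i)) = 0"
      using proj0[of d] True by blast
    then show ?thesis using s0 insert.hyps by (intro bexI[of _ p]) auto
  next
    case False
    then obtain u where u: "u \<in> L" "u s \<noteq> 0" by (auto simp: L0_def)
    define ip where "ip x y = (\<Sum>i\<in>insert s S. x i * cnj (y i))" for x y :: "'i \<Rightarrow> complex"
    have ip_lin: "ip (\<lambda>i. a i + c * b i) y = ip a y + c * ip b y"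
      "ip y (\<lambda>i. a i + c * b i) = ip y a + cnj c * ip y b" for a b c y
      by (simp_all add: ip_def sum.distrib sum_distrib_left algebra_simps)
    have ip_cnj: "ip x y = cnj (ip y x)" for x y by (simp add: ip_def mult.commute)
    have ip0: "ip x y = (\<Sum>i\<in>S. x i * cnj (y i))" if "y \<in> L0" for x y
      using that insert.hyps by (simp add: ip_def L0_def)
    have ip_cong: "ip x y = ip x' y'" if "\<forall>i\<in>insert s S. x i = x' i" "\<forall>i\<in>insert s S. y i = y' i"
      for x x' y y' unfolding ip_def using that by (intro sum.cong) auto
    \<comment> \<open>Gram--Schmidt: \<open>v\<close> spans the orthogonal complement of \<open>L0\<close> in \<open>L\<close>.\<close>
    obtain q where q: "q \<in> L0" "\<forall>y\<in>L0. (\<Sum>i\<in>S. (u i - q i) * cnj (y i)) = 0" using proj0 by blast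
    obtain v where v: "v \<in> L" "\<forall>i\<in>insert s S. v i = u i + (-1) * q i"
      using insert.prems(2)[of u q "-1"] u q unfolding L0_def by blast
    have vs: "v s \<noteq> 0" using v u q by (auto simp: L0_def)
    have v0: "ip v y = 0" if "y \<in> L0" for y
      using q(2) that v(2) by (simp add: ip0[OF that])
    have N: "ip v v \<noteq> 0"
    proof -
      have "ip v v = of_real (\<Sum>i\<in>insert s S. (cmod (v i))\<^sup>2)"
        unfolding ip_def of_real_sum by (intro sum.cong refl) (simp only: complex_norm_square)
      moreover have "(\<Sum>i\<in>insert s S. (cmod (v i))\<^sup>2) > 0"
        using insert.hyps vs by (intro sum_pos2[of _ s]) auto
      ultimately show ?thesis by (metis of_real_eq_0_iff less_irrefl)
    qed
    obtain p1 where p1: "p1 \<in> L0" "\<forall>y\<in>L0. (\<Sum>i\<in>S. (d i - p1 i) * cnj (y i)) = 0"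
      using proj0 by blast
    define k where "k = ip d v / ip v v"
    obtain p where p: "p \<in> L" "\<forall>i\<in>insert s S. p i = p1 i + k * v i"
      using insert.prems(2)[of p1 v k] v p1 unfolding L0_def by blast
    have dp: "ip (\<lambda>i. d i - p i) y = ip (\<lambda>i. d i - p1 i) y - k * ip v y" for y
    proof -
      have "ip (\<lambda>i. d i - p i) y = ip (\<lambda>i. (d i - p1 i) + (- k) * v i) y"
        by (rule ip_cong) (use p(2) in auto)
      then show ?thesis by (simp only: ip_lin) simp
    qed
    have "ip (\<lambda>i. d i - p1 i) v = ip d v - ip p1 v"
      using ip_lin(1)[of d "-1" p1 v] by simp
    moreover have "ip p1 v = 0" using ip_cnj[of p1 v] v0[OF p1(1)] by simp
    ultimately have ortv: "ip (\<lambda>i. d i - p i) v = 0" using N by (simp add: dp k_def)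
    have "ip (\<lambda>i. d i - p i) y = 0" if y: "y \<in> L" for y
    proof -
      obtain z where z: "z \<in> L" "\<forall>i\<in>insert s S. z i = y i + (- (y s / v s)) * v i"
        using insert.prems(2)[of y v "- (y s / v s)"] v y by blast
      have z0: "z \<in> L0" using z vs by (auto simp: L0_def)
      have "ip (\<lambda>i. d i - p i) y = ip (\<lambda>i. d i - p i) (\<lambda>i. z i + (y s / v s) * v i)"
        by (rule ip_cong) (use z(2) in auto)
      also have "\<dots> = ip (\<lambda>i. d i - p i) z"
        unfolding ip_lin(2)[of _ z "y s / v s" v] using ortv by simp
      also have "\<dots> = 0" using p1(2) z0 v0[OF z0] by (simp add: dp ip0[OF z0])
      finally show ?thesis .
    qed
    then show ?thesis using p(1) unfolding ip_def by blast
  qed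
qed

lemma convergent_subsequence_on_finite_set:
  fixes f :: "nat \<Rightarrow> 'i \<Rightarrow> real"
  assumes "finite S" and bd: "\<And>n i. f n i \<in> {0..1}"
  shows "\<exists>r. strict_mono r \<and> (\<forall>i\<in>S. convergent (\<lambda>n. f (r n) i))"
  using assms(1)
proof (induction S rule: finite_induct)
  case empty
  show ?case using strict_mono_id by auto
next
  case (insert s S)
  then obtain r where r: "strict_mono r" "\<forall>i\<in>S. convergent (\<lambda>n. f (r n) i)" by blast
  have "seq_compact {0..1::real}" using compact_Icc compact_imp_seq_compact by blast
  then obtain l r' where r': "strict_mono r'" "((\<lambda>n. f (r n) s) \<circ> r') \<longlonglongrightarrow> l"
    using bd unfolding seq_compact_def by metis
  have "convergent (\<lambda>n. f (r (r' n)) i)" if "i \<in> S" for i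
    using convergent_subseq_convergent[OF _ r'(1), of "\<lambda>n. f (r n) i"] r(2) that
    by (auto simp: o_def)
  moreover have "convergent (\<lambda>n. f (r (r' n)) s)" using r'(2) by (auto simp: o_def convergent_def)
  ultimately show ?case
    using strict_mono_o[OF r(1) r'(1)] by (intro exI[of _ "r \<circ> r'"]) (auto simp: o_def)
qed

section \<open>Conditioning a Markov chain on its past\<close>

text \<open>The Markov property is stated for one complete history at a time. An event about the past is a
  finite disjoint union of histories, and the present state being fixed as \<open>x\<close>, all of them have the same
  transition probability.\<close>

lemma markov_chain_history:
  assumes mc: "markov_chain M S P Y" and xy: "x \<in> S" "y \<in> S"
  shows "\<P>(\<omega> in M. Y (Suc t) \<omega> = y \<and> Y t \<omega> = x \<and> (\<forall>i\<le>t. Q i (Y i \<omega>))) =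
         \<P>(\<omega> in M. Y t \<omega> = x \<and> (\<forall>i\<le>t. Q i (Y i \<omega>))) * P x y"
proof -
  interpret prob_space M using mc by (simp add: markov_chain_def)
  have fin: "finite S" and meas [measurable]: "\<And>t. Y t \<in> measurable M (count_space S)"
    using mc by (auto simp: markov_chain_def)
  have inS: "Y i \<omega> \<in> S" if "\<omega> \<in> space M" for i \<omega>
    using measurable_space[OF meas that] by simp
  define F where "F = {s \<in> {..t} \<rightarrow>\<^sub>E S. s t = x \<and> (\<forall>i\<le>t. Q i (s i))}"
  have "finite F" unfolding F_def using fin by (simp add: finite_PiE)
  have ev: "{\<omega>\<in>space M. \<forall>i\<le>t. Y i \<omega> = s i} \<in> sets M" if "s \<in> F" for s
  proof -
    have "{\<omega>\<in>space M. Y i \<omega> = s i} \<in> sets M" if "i \<le> t" for i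
    proof -
      have "Y i -` {s i} \<inter> space M \<in> sets M"
        using \<open>s \<in> F\<close> that by (intro measurable_sets[OF meas]) (auto simp: F_def PiE_def Pi_def)
      then show ?thesis by (simp add: vimage_def Int_def conj_commute)
    qed
    then have "{\<omega>\<in>space M. \<forall>i\<in>{..t}. Y i \<omega> = s i} \<in> sets M"
      by (intro sets.sets_Collect_finite_All) auto
    then show ?thesis by simp
  qed
  have ev': "{\<omega>\<in>space M. Y (Suc t) \<omega> = y} \<in> sets M"
  proof -
    have "Y (Suc t) -` {y} \<inter> space M \<in> sets M"
      using xy by (intro measurable_sets[OF meas]) auto
    then show ?thesis by (simp add: vimage_def Int_def conj_commute)
  qed
  have disj: "s = s'" if "s \<in> F" "s' \<in> F" "\<forall>i\<le>t. Y i \<omega> = s i" "\<forall>i\<le>t. Y i \<omega> = s' i" for s s' \<omega>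
    using that unfolding F_def by (intro PiE_ext[of s "{..t}" "\<lambda>_. S" s']) auto
  have split: "\<exists>s\<in>F. \<forall>i\<le>t. Y i \<omega> = s i"
    if "\<omega> \<in> space M" "Y t \<omega> = x" "\<forall>i\<le>t. Q i (Y i \<omega>)" for \<omega>
    using that inS by (intro bexI[of _ "\<lambda>i\<in>{..t}. Y i \<omega>"]) (auto simp: F_def)
  have "{\<omega>\<in>space M. Y t \<omega> = x \<and> (\<forall>i\<le>t. Q i (Y i \<omega>))} = (\<Union>s\<in>F. {\<omega>\<in>space M. \<forall>i\<le>t. Y i \<omega> = s i})"
    using split by (fastforce simp: F_def)
  then have 1: "\<P>(\<omega> in M. Y t \<omega> = x \<and> (\<forall>i\<le>t. Q i (Y i \<omega>))) =
      (\<Sum>s\<in>F. \<P>(\<omega> in M. \<forall>i\<le>t. Y i \<omega> = s i))"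
    using \<open>finite F\<close> ev disj
    by (simp only:, intro finite_measure_finite_Union) (auto simp: disjoint_family_on_def)
  have "{\<omega>\<in>space M. Y (Suc t) \<omega> = y \<and> Y t \<omega> = x \<and> (\<forall>i\<le>t. Q i (Y i \<omega>))} =
      (\<Union>s\<in>F. {\<omega>\<in>space M. Y (Suc t) \<omega> = y \<and> (\<forall>i\<le>t. Y i \<omega> = s i)})"
    using split by (fastforce simp: F_def)
  then have 2: "\<P>(\<omega> in M. Y (Suc t) \<omega> = y \<and> Y t \<omega> = x \<and> (\<forall>i\<le>t. Q i (Y i \<omega>))) =
      (\<Sum>s\<in>F. \<P>(\<omega> in M. Y (Suc t) \<omega> = y \<and> (\<forall>i\<le>t. Y i \<omega> = s i)))"
    using \<open>finite F\<close> ev ev' disj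
    by (simp only:, intro finite_measure_finite_Union)
      (auto simp: disjoint_family_on_def intro!: sets.sets_Collect_conj)
  have step: "\<P>(\<omega> in M. Y (Suc t) \<omega> = y \<and> (\<forall>i\<le>t. Y i \<omega> = s i)) =
      \<P>(\<omega> in M. \<forall>i\<le>t. Y i \<omega> = s i) * P x y" if s: "s \<in> F" for s
  proof (cases "\<P>(\<omega> in M. \<forall>i\<le>t. Y i \<omega> = s i) = 0")
    case True
    have "\<P>(\<omega> in M. Y (Suc t) \<omega> = y \<and> (\<forall>i\<le>t. Y i \<omega> = s i)) \<le> \<P>(\<omega> in M. \<forall>i\<le>t. Y i \<omega> = s i)"
      using ev[OF s] by (intro finite_measure_mono) auto
    then show ?thesis using True by (simp add: measure_le_0_iff)
  next
    case False
    define s' where "s' = s(Suc t := y)"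
    have s': "\<And>i. i \<le> t \<Longrightarrow> s' i = s i" "s' (Suc t) = y" by (auto simp: s'_def)
    have "s i \<in> S" if "i \<le> t" for i using s that by (auto simp: F_def PiE_def Pi_def)
    then have "\<forall>i\<le>Suc t. s' i \<in> S" using xy s' by (auto simp: le_Suc_eq)
    moreover have "\<P>(\<omega> in M. \<forall>i\<le>t. Y i \<omega> = s' i) > 0"
      using False by (simp add: s' zero_less_measure_iff)
    ultimately have "\<P>(\<omega> in M. Y (Suc t) \<omega> = s' (Suc t) \<bar> \<forall>i\<le>t. Y i \<omega> = s' i) = P (s' t) (s' (Suc t))"
      using mc unfolding markov_chain_def by blast
    moreover have "s' t = x" using s by (simp add: s' F_def)
    ultimately show ?thesis using False by (simp add: s' cond_prob_def field_simps)
  qed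
  show ?thesis unfolding 1 2 sum_distrib_right by (intro sum.cong refl step)
qed

section \<open>The group algebra and the left cosets of a subgroup\<close>

locale finite_group_subgroup = group G for G :: "('a, 'm) monoid_scheme" (structure) +
  fixes H :: "'a set"
  assumes fin: "finite (carrier G)" and sub: "subgroup H G"
begin

abbreviation coset :: "'a \<Rightarrow> 'a set" where "coset g \<equiv> g <# H"

abbreviation conv (infixl "\<diamondop>" 70) where "x \<diamondop> y \<equiv> x \<otimes>\<^bsub>group_algebra G\<^esub> y"

sublocale galg: ring "group_algebra G"
  by (rule group_algebra_ring[OF fin])

definition aug :: "('a \<Rightarrow> complex) \<Rightarrow> complex" where
  "aug x = (\<Sum>g\<in>carrier G. x g)"

definition coset_part :: "'a set \<Rightarrow> ('a \<Rightarrow> complex) \<Rightarrow> 'a \<Rightarrow> complex" where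
  "coset_part K x = (\<lambda>g\<in>carrier G. if coset g = K then x g else 0)"

definition smult :: "complex \<Rightarrow> ('a \<Rightarrow> complex) \<Rightarrow> 'a \<Rightarrow> complex" where
  "smult s x = (\<lambda>g\<in>carrier G. s * x g)"

abbreviation point :: "'a \<Rightarrow> 'a \<Rightarrow> complex" where
  "point k \<equiv> (\<lambda>g\<in>carrier G. if g = k then 1 else 0)"

lemma H_sub: "H \<subseteq> carrier G" using sub by (rule subgroup.subset)

lemma finH: "finite H" using H_sub fin by (rule finite_subset)

lemma cardH: "card H > 0"
  using finH subgroup.one_closed[OF sub] by (auto simp: card_gt_0_iff)

lemma carrier_galg: "carrier (group_algebra G) = carrier G \<rightarrow>\<^sub>E UNIV"
  by (rule group_algebra_simps)

lemma galg_ext: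
  assumes "x \<in> carrier (group_algebra G)" "y \<in> carrier (group_algebra G)" "\<And>g. g \<in> carrier G \<Longrightarrow> x g = y g"
  shows "x = y"
  using assms unfolding carrier_galg by (rule galg_eqI)

lemma galg_closed [simp]:
  "restrict f (carrier G) \<in> carrier (group_algebra G)"
  "galg_of G r \<in> carrier (group_algebra G)" "eta G K \<in> carrier (group_algebra G)"
  "coset_part K x \<in> carrier (group_algebra G)" "smult s x \<in> carrier (group_algebra G)"
  by (simp_all add: carrier_galg galg_of_def eta_def coset_part_def smult_def)

lemma conv_apply: "g \<in> carrier G \<Longrightarrow> (x \<diamondop> y) g = (\<Sum>h\<in>carrier G. x h * y (inv h \<otimes> g))"
  by (simp add: group_algebra_simps)

lemma group_cancel:
  assumes "h \<in> carrier G" "g \<in> carrier G"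
  shows "inv h \<otimes> (h \<otimes> g) = g" "h \<otimes> (inv h \<otimes> g) = g" "g \<otimes> inv h \<otimes> h = g" "g \<otimes> h \<otimes> inv h = g"
    "inv (g \<otimes> inv h) \<otimes> g = h"
proof -
  show "inv h \<otimes> (h \<otimes> g) = g" "h \<otimes> (inv h \<otimes> g) = g"
    using assms by (simp_all add: m_assoc[symmetric])
  show "g \<otimes> inv h \<otimes> h = g" "g \<otimes> h \<otimes> inv h = g"
    using assms by (simp_all add: m_assoc)
  show "inv (g \<otimes> inv h) \<otimes> g = h" using assms by (simp add: inv_mult_group m_assoc)
qed

lemma coset_eq_iff:
  assumes "h \<in> carrier G" "g \<in> carrier G"
  shows "coset h = coset g \<longleftrightarrow> inv h \<otimes> g \<in> H"
proof
  assume "coset h = coset g"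
  then have "g \<in> coset h" using lcos_self[OF assms(2) sub] by simp
  then show "inv h \<otimes> g \<in> H"
    using subgroup.lcos_module_imp[OF sub is_group assms(1)] by simp
next
  assume "inv h \<otimes> g \<in> H"
  then have "g \<in> coset h"
    unfolding l_coset_def using group_cancel(2)[OF assms] by force
  then show "coset h = coset g" using l_repr_independence assms(1) sub by blast
qed

lemma coset_eq_H_iff: "g \<in> carrier G \<Longrightarrow> coset g = H \<longleftrightarrow> g \<in> H"
  using coset_eq_iff[of \<one> g] lcos_mult_one[OF H_sub] by auto

lemma translate_coset:
  "h \<in> carrier G \<Longrightarrow> g \<in> carrier G \<Longrightarrow> coset (inv h \<otimes> g) = K \<Longrightarrow> h <# K = coset g"
  using H_sub by (auto simp: lcos_m_assoc group_cancel)

lemma card_coset: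
  assumes "k \<in> carrier G"
  shows "card {g\<in>carrier G. coset g = coset k} = card H"
proof -
  have "bij_betw (\<lambda>h. k \<otimes> h) H {g\<in>carrier G. coset g = coset k}"
  proof (rule bij_betw_byWitness[where f' = "\<lambda>g. inv k \<otimes> g"])
    show "(\<lambda>h. k \<otimes> h) ` H \<subseteq> {g\<in>carrier G. coset g = coset k}"
    proof (rule image_subsetI)
      fix h assume h: "h \<in> H"
      then have hG: "h \<in> carrier G" using H_sub by blast
      have "coset k = coset (k \<otimes> h)"
        using h hG assms by (subst coset_eq_iff) (auto simp: group_cancel)
      then show "k \<otimes> h \<in> {g\<in>carrier G. coset g = coset k}" using hG assms by simp
    qed
    show "(\<lambda>g. inv k \<otimes> g) ` {g\<in>carrier G. coset g = coset k} \<subseteq> H"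
      using assms coset_eq_iff[OF assms] by auto
  qed (use assms H_sub in \<open>auto simp: subset_iff group_cancel\<close>)
  then show ?thesis by (simp add: bij_betw_same_card)
qed

lemma coset_in_lcosets: "g \<in> carrier G \<Longrightarrow> coset g \<in> lcosets H"
  by (auto simp: LCOSETS_def)

lemma lcosetsE: assumes "K \<in> lcosets H" obtains k where "k \<in> carrier G" "K = coset k"
  using assms by (auto simp: LCOSETS_def)

lemma finite_lcosets: "finite (lcosets H)"
  using fin by (simp add: LCOSETS_def)

lemma sum_over_cosets:
  fixes f :: "'a \<Rightarrow> 'c::comm_monoid_add"
  shows "(\<Sum>K\<in>lcosets H. \<Sum>g\<in>carrier G. if coset g = K then f g else 0) = (\<Sum>g\<in>carrier G. f g)"
proof -
  have "(\<Sum>K\<in>lcosets H. \<Sum>g\<in>carrier G. if coset g = K then f g else 0) =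
      (\<Sum>g\<in>carrier G. \<Sum>K\<in>lcosets H. if coset g = K then f g else 0)" by (rule sum.swap)
  also have "\<dots> = (\<Sum>g\<in>carrier G. f g)"
    by (intro sum.cong refl) (simp add: finite_lcosets coset_in_lcosets)
  finally show ?thesis .
qed

lemma sum_right_translate:
  fixes f :: "'a \<Rightarrow> 'c::comm_monoid_add"
  assumes "k \<in> carrier G"
  shows "(\<Sum>g\<in>carrier G. f (g \<otimes> k)) = (\<Sum>g\<in>carrier G. f g)"
  by (rule sum.reindex_bij_witness[of _ "\<lambda>g. g \<otimes> inv k" "\<lambda>g. g \<otimes> k"])
    (use assms in \<open>auto simp: group_cancel\<close>)

lemma sum_left_translate:
  fixes f :: "'a \<Rightarrow> 'c::comm_monoid_add"
  assumes "k \<in> carrier G"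
  shows "(\<Sum>g\<in>carrier G. f (k \<otimes> g)) = (\<Sum>g\<in>carrier G. f g)"
  by (rule sum.reindex_bij_witness[of _ "\<lambda>g. inv k \<otimes> g" "\<lambda>g. k \<otimes> g"])
    (use assms in \<open>auto simp: group_cancel\<close>)

lemma sum_left_division:
  fixes f :: "'a \<Rightarrow> 'a \<Rightarrow> 'c::comm_monoid_add"
  assumes "g \<in> carrier G"
  shows "(\<Sum>h\<in>carrier G. f h (inv h \<otimes> g)) = (\<Sum>k\<in>carrier G. f (g \<otimes> inv k) k)"
  by (rule sum.reindex_bij_witness[of _ "\<lambda>k. g \<otimes> inv k" "\<lambda>h. inv h \<otimes> g"])
    (use assms in \<open>auto simp: group_cancel inv_mult_group m_assoc[symmetric]\<close>)

lemma aug_conv: "aug (x \<diamondop> y) = aug x * aug y"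
proof -
  have "aug (x \<diamondop> y) = (\<Sum>g\<in>carrier G. \<Sum>h\<in>carrier G. x h * y (inv h \<otimes> g))"
    unfolding aug_def by (intro sum.cong refl) (simp add: conv_apply)
  also have "\<dots> = (\<Sum>h\<in>carrier G. \<Sum>g\<in>carrier G. x h * y (inv h \<otimes> g))" by (rule sum.swap)
  also have "\<dots> = (\<Sum>h\<in>carrier G. x h * aug y)"
    unfolding aug_def by (intro sum.cong refl) (simp add: sum_distrib_left[symmetric] sum_left_translate)
  finally show ?thesis by (simp add: aug_def sum_distrib_right)
qed

lemma point_conv:
  assumes "k \<in> carrier G" "g \<in> carrier G"
  shows "(point k \<diamondop> x) g = x (inv k \<otimes> g)"
proof -
  have "(point k \<diamondop> x) g = (\<Sum>h\<in>carrier G. if h = k then x (inv h \<otimes> g) else 0)"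
    using assms by (auto simp: conv_apply intro!: sum.cong)
  then show ?thesis using assms fin by simp
qed

lemma smult_eq_conv: "x \<in> carrier (group_algebra G) \<Longrightarrow> smult s x = smult s (point \<one>) \<diamondop> x"
proof (rule galg_ext)
  fix g assume x: "x \<in> carrier (group_algebra G)" and g: "g \<in> carrier G"
  have "(smult s (point \<one>) \<diamondop> x) g = (\<Sum>h\<in>carrier G. if h = \<one> then s * x (inv h \<otimes> g) else 0)"
    using g by (auto simp: conv_apply smult_def intro!: sum.cong)
  then show "smult s x g = (smult s (point \<one>) \<diamondop> x) g"
    using g fin by (simp add: smult_def)
qed auto

lemma smult_conv:
  assumes "x \<in> carrier (group_algebra G)" "y \<in> carrier (group_algebra G)"
  shows "smult s x \<diamondop> y = smult s (x \<diamondop> y)"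
  using assms by (simp add: smult_eq_conv[of x] smult_eq_conv[of "x \<diamondop> y"] galg.m_assoc)

text \<open>Multiplication by \<open>e\<close> from the right acts within each coset.\<close>

lemma coset_part_conv:
  assumes e: "e \<in> galg_sub G H"
  shows "coset_part K (x \<diamondop> e) = coset_part K x \<diamondop> e"
proof (rule galg_ext)
  fix g assume g: "g \<in> carrier G"
  have e0: "e (inv h \<otimes> g) = 0" if "h \<in> carrier G" "coset h \<noteq> coset g" for h
    using that g e coset_eq_iff[of h g] by (auto simp: galg_sub_def)
  show "coset_part K (x \<diamondop> e) g = (coset_part K x \<diamondop> e) g"
  proof (cases "coset g = K")
    case True
    then show ?thesis using g e0 by (auto simp: coset_part_def conv_apply intro!: sum.cong)
  next
    case False
    have "coset_part K x h * e (inv h \<otimes> g) = 0" if "h \<in> carrier G" for h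
      using that False e0[OF that] by (cases "coset h = coset g") (simp_all add: coset_part_def)
    then have "(coset_part K x \<diamondop> e) g = 0"
      unfolding conv_apply[OF g] by (rule sum.neutral[rule_format])
    then show ?thesis using False g by (simp add: coset_part_def)
  qed
qed (use e in \<open>auto simp: galg_sub_def\<close>)

text \<open>Right multiplication by \<open>\<eta>\<close> spreads the mass of every left coset evenly over it.\<close>

lemma conv_eta_apply:
  assumes g: "g \<in> carrier G"
  shows "(x \<diamondop> eta G H) g = (\<Sum>h\<in>carrier G. if coset h = coset g then x h else 0) / card H"
  unfolding conv_apply[OF g] sum_divide_distrib
  using g by (intro sum.cong refl) (auto simp: eta_def coset_eq_iff)

lemma conv_eta_supported:
  assumes x: "coset_part K x = x" and g: "g \<in> carrier G"
  shows "(x \<diamondop> eta G H) g = (if coset g = K then aug x / card H else 0)"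
proof -
  have x0: "x h = 0" if "h \<in> carrier G" "coset h \<noteq> K" for h
  proof -
    have "coset_part K x h = 0" using that by (simp add: coset_part_def)
    then show ?thesis by (simp only: x)
  qed
  show ?thesis
  proof (cases "coset g = K")
    case True
    then have "(\<Sum>h\<in>carrier G. if coset h = coset g then x h else 0) = aug x"
      unfolding aug_def by (intro sum.cong refl) (simp add: x0)
    then show ?thesis using True by (simp add: conv_eta_apply[OF g])
  next
    case False
    then have "(\<Sum>h\<in>carrier G. if coset h = coset g then x h else 0) = 0"
      using x0 by (intro sum.neutral) auto
    then show ?thesis using False by (simp add: conv_eta_apply[OF g])
  qed
qed

lemma galg_sub_iff: "e \<in> galg_sub G H \<longleftrightarrow> e \<in> carrier (group_algebra G) \<and> coset_part H e = e"
proof -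
  have "coset_part H e = e \<longleftrightarrow> (\<forall>g\<in>carrier G - H. e g = 0)" if e: "e \<in> carrier (group_algebra G)"
  proof
    assume "coset_part H e = e"
    moreover have "coset_part H e g = 0" if "g \<in> carrier G - H" for g
      using that by (simp add: coset_part_def coset_eq_H_iff)
    ultimately show "\<forall>g\<in>carrier G - H. e g = 0" by simp
  next
    assume "\<forall>g\<in>carrier G - H. e g = 0"
    then show "coset_part H e = e"
      using e by (intro galg_ext) (auto simp: coset_part_def coset_eq_H_iff)
  qed
  then show ?thesis by (auto simp: galg_sub_def)
qed

text \<open>An element supported on \<open>H\<close> acts as its augmentation when multiplied with the average over
  \<open>H\<close>, from either side.\<close>

lemma
  assumes e: "e \<in> galg_sub G H" and a: "aug e = 1"
  shows conv_eta: "e \<diamondop> eta G H = eta G H" and eta_conv: "eta G H \<diamondop> e = eta G H"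
proof -
  have eA: "e \<in> carrier (group_algebra G)" and eH: "coset_part H e = e" using e by (auto simp: galg_sub_iff)
  show "e \<diamondop> eta G H = eta G H"
    by (rule galg_ext) (use eA a conv_eta_supported[OF eH] in \<open>auto simp: eta_def coset_eq_H_iff\<close>)
  show "eta G H \<diamondop> e = eta G H"
  proof (rule galg_ext)
    fix g assume g: "g \<in> carrier G"
    have e0: "e k = 0" if "k \<in> carrier G" "k \<notin> H" for k using e that by (auto simp: galg_sub_def)
    have mem: "g \<otimes> inv k \<in> H \<longleftrightarrow> g \<in> H" if "k \<in> H" for k
    proof
      assume "g \<otimes> inv k \<in> H"
      then have "g \<otimes> inv k \<otimes> k \<in> H" using that subgroup.m_closed[OF sub] by blast
      then show "g \<in> H" using that H_sub g by (auto simp: group_cancel)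
    qed (use that sub in \<open>simp add: subgroup.m_closed subgroup.m_inv_closed\<close>)
    have "(eta G H \<diamondop> e) g = (\<Sum>k\<in>carrier G. eta G H (g \<otimes> inv k) * e k)"
      using g by (simp add: conv_apply sum_left_division[of g "\<lambda>h k. eta G H h * e k"])
    also have "\<dots> = (\<Sum>k\<in>carrier G. eta G H g * e k)"
    proof (rule sum.cong)
      fix k assume k: "k \<in> carrier G"
      show "eta G H (g \<otimes> inv k) * e k = eta G H g * e k"
        using k g e0[OF k] mem[of k] by (cases "k \<in> H") (auto simp: eta_def)
    qed simp
    also have "\<dots> = eta G H g" using a by (simp add: sum_distrib_left[symmetric] aug_def)
    finally show "(eta G H \<diamondop> e) g = eta G H g" .
  qed (use eA in auto)
qed

lemma PIdl_idempotent_iff: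
  assumes "e \<in> carrier (group_algebra G)" "e \<diamondop> e = e"
  shows "x \<in> PIdl\<^bsub>group_algebra G\<^esub> e \<longleftrightarrow> x \<in> carrier (group_algebra G) \<and> x \<diamondop> e = x"
  unfolding cgenideal_def
proof safe
  fix y assume "y \<in> carrier (group_algebra G)"
  then show "y \<diamondop> e \<in> carrier (group_algebra G)" "y \<diamondop> e \<diamondop> e = y \<diamondop> e"
    using assms by (simp_all add: galg.m_assoc)
next
  assume "x \<in> carrier (group_algebra G)" "x \<diamondop> e = x"
  then show "\<exists>y. x = y \<diamondop> e \<and> y \<in> carrier (group_algebra G)" by metis
qed

section \<open>Left ideals are generated by idempotents\<close>

text \<open>The standard Hermitian form on \<open>\<complex>[G]\<close> is invariant under left translation, so the orthogonal
  complement of a left ideal \<open>L\<close> is a left ideal too. Split the unit as \<open>e + f\<close> along \<open>L\<close> and its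
  complement. For \<open>x \<in> L\<close> the element \<open>x f = x - x e\<close> then lies in both, hence vanishes.\<close>

theorem left_ideal_idempotent:
  assumes LA: "L \<subseteq> carrier (group_algebra G)" and L0: "L \<noteq> {}"
    and add: "\<And>x y. x \<in> L \<Longrightarrow> y \<in> L \<Longrightarrow> x \<oplus>\<^bsub>group_algebra G\<^esub> y \<in> L"
    and left: "\<And>a x. a \<in> carrier (group_algebra G) \<Longrightarrow> x \<in> L \<Longrightarrow> a \<diamondop> x \<in> L"
    and part: "\<And>x. x \<in> L \<Longrightarrow> coset_part H x \<in> L"
  obtains e where "e \<in> L" "e \<in> galg_sub G H" "\<And>x. x \<in> L \<Longrightarrow> x \<diamondop> e = x"
proof -
  have comb: "(\<lambda>i\<in>carrier G. x i + c * y i) \<in> L" if x: "x \<in> L" and y: "y \<in> L" for x y c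
  proof -
    have "smult c y \<in> L" using y left[of "smult c (point \<one>)" y] LA
      by (metis galg_closed(5) smult_eq_conv subsetD)
    then have "x \<oplus>\<^bsub>group_algebra G\<^esub> smult c y \<in> L" using x add by blast
    moreover have "x \<oplus>\<^bsub>group_algebra G\<^esub> smult c y = (\<lambda>i\<in>carrier G. x i + c * y i)"
      by (auto simp: group_algebra_simps smult_def)
    ultimately show ?thesis by simp
  qed
  obtain e where eL: "e \<in> L"
    and orth: "\<And>y. y \<in> L \<Longrightarrow> (\<Sum>i\<in>carrier G. (point \<one> i - e i) * cnj (y i)) = 0"
  proof -
    have "\<exists>z\<in>L. \<forall>i\<in>carrier G. z i = x i + c * y i" if "x \<in> L" "y \<in> L" for x y c
      using comb[OF that] by (intro bexI[of _ "\<lambda>i\<in>carrier G. x i + c * y i"]) auto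
    from exists_orthogonal_projection[OF fin L0 this, of "point \<one>"] that show thesis by blast
  qed
  have eA: "e \<in> carrier (group_algebra G)" using eL LA by blast
  define f where "f = (\<lambda>i\<in>carrier G. point \<one> i - e i)"
  have fA: "f \<in> carrier (group_algebra G)" by (simp add: f_def)
  have norm0: "x i = 0" if "(\<Sum>i\<in>carrier G. x i * cnj (x i)) = 0" "i \<in> carrier G" for x i
  proof -
    have "(\<Sum>i\<in>carrier G. x i * cnj (x i)) = of_real (\<Sum>i\<in>carrier G. (cmod (x i))\<^sup>2)"
      unfolding of_real_sum by (intro sum.cong refl) (simp only: complex_norm_square)
    then have "(\<Sum>i\<in>carrier G. (cmod (x i))\<^sup>2) = 0" using that(1) by (metis of_real_eq_0_iff)
    then show ?thesis using fin that(2) by (simp add: sum_nonneg_eq_0_iff)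
  qed
  have e_right: "x \<diamondop> e = x" if x: "x \<in> L" for x
  proof -
    have xA: "x \<in> carrier (group_algebra G)" using x LA by blast
    have xe: "x \<diamondop> e \<in> L" using left[OF xA eL] .
    define y where "y = (\<lambda>i\<in>carrier G. x i + (-1) * (x \<diamondop> e) i)"
    have yL: "y \<in> L" unfolding y_def by (rule comb[OF x xe])
    have y: "y i = (\<Sum>h\<in>carrier G. x h * f (inv h \<otimes> i))" if i: "i \<in> carrier G" for i
    proof -
      have "x i = (x \<diamondop> point \<one>) i"
        using galg.r_one[OF xA] by (simp add: group_algebra_simps(3))
      then have "y i = (\<Sum>h\<in>carrier G. x h * point \<one> (inv h \<otimes> i)) - (\<Sum>h\<in>carrier G. x h * e (inv h \<otimes> i))"
        using i by (simp add: y_def conv_apply)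
      also have "\<dots> = (\<Sum>h\<in>carrier G. x h * f (inv h \<otimes> i))"
        unfolding sum_subtractf[symmetric]
        using i by (intro sum.cong refl) (auto simp: f_def algebra_simps)
      finally show ?thesis .
    qed
    \<comment> \<open>The product \<open>x f\<close> combines left translates of \<open>f\<close>, all orthogonal to \<open>y \<in> L\<close>.\<close>
    have "(\<Sum>i\<in>carrier G. y i * cnj (y i)) =
        (\<Sum>i\<in>carrier G. \<Sum>h\<in>carrier G. x h * (f (inv h \<otimes> i) * cnj (y i)))"
      by (intro sum.cong refl) (simp add: y[symmetric] sum_distrib_right[symmetric] mult.assoc[symmetric])
    also have "\<dots> = (\<Sum>h\<in>carrier G. \<Sum>i\<in>carrier G. x h * (f (inv h \<otimes> i) * cnj (y i)))"
      by (rule sum.swap)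
    also have "\<dots> = 0"
    proof (rule sum.neutral, rule ballI)
      fix h assume h: "h \<in> carrier G"
      have "(\<Sum>i\<in>carrier G. f (inv h \<otimes> i) * cnj (y i)) = (\<Sum>i\<in>carrier G. f i * cnj (y (h \<otimes> i)))"
        using sum_left_translate[of h "\<lambda>i. f (inv h \<otimes> i) * cnj (y i)"] h
        by (simp add: group_cancel cong: sum.cong)
      also have "\<dots> = (\<Sum>i\<in>carrier G. (point \<one> i - e i) * cnj ((point (inv h) \<diamondop> y) i))"
        using h by (intro sum.cong refl) (simp add: point_conv f_def)
      also have "\<dots> = 0" by (rule orth) (rule left[OF _ yL], simp)
      finally show "(\<Sum>i\<in>carrier G. x h * (f (inv h \<otimes> i) * cnj (y i))) = 0"
        by (simp add: sum_distrib_left[symmetric])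
    qed
    finally have "y i = 0" if "i \<in> carrier G" for i using norm0 that by blast
    then have "(x \<diamondop> e) i = x i" if "i \<in> carrier G" for i using that by (simp add: y_def)
    then show ?thesis using xA eA by (intro galg_ext) auto
  qed
  have "coset_part H e = e"
  proof -
    \<comment> \<open>The part of \<open>e\<close> off \<open>H\<close> lies in \<open>L\<close>. The unit is supported in \<open>H\<close>, so it is orthogonal to that part.\<close>
    define y where "y = (\<lambda>i\<in>carrier G. e i + (-1) * coset_part H e i)"
    have yL: "y \<in> L" unfolding y_def by (rule comb[OF eL part[OF eL]])
    have y: "y i = (if i \<in> H then 0 else e i)" if "i \<in> carrier G" for i
      using that by (simp add: y_def coset_part_def coset_eq_H_iff)
    have "(\<Sum>i\<in>carrier G. (point \<one> i - e i) * cnj (y i)) = - (\<Sum>i\<in>carrier G. y i * cnj (y i))"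
      unfolding sum_negf[symmetric]
      using y subgroup.one_closed[OF sub] by (intro sum.cong refl) auto
    then have "(\<Sum>i\<in>carrier G. y i * cnj (y i)) = 0" using orth[OF yL] by simp
    then have "y i = 0" if "i \<in> carrier G" for i using norm0 that by blast
    then show ?thesis using eA by (intro galg_ext) (auto simp: y_def)
  qed
  then have "e \<in> galg_sub G H" using eA by (simp add: galg_sub_iff)
  then show thesis using that eL e_right by blast
qed

section \<open>Irreducibility\<close>

text \<open>Summing \<open>w(k) (a(g k\<^sup>-\<^sup>1) - a(g))\<^sup>2\<close> over all \<open>g\<close> and \<open>k\<close> and expanding the square gives
  \<open>W S - 2 W S + W S = 0\<close>, where \<open>W\<close> is the total weight and \<open>S\<close> the sum of the \<open>a(g)\<^sup>2\<close>. Hence \<open>a\<close> is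
  invariant under right translation by the support of \<open>w\<close>, and by the group generated by it.\<close>

lemma harmonic_constant:
  fixes a w :: "'a \<Rightarrow> real"
  assumes w: "irreducible_weight G w"
    and inv: "\<And>g. g \<in> carrier G \<Longrightarrow> (\<Sum>h\<in>carrier G. a h * w (inv h \<otimes> g)) = sum w (carrier G) * a g"
    and "g \<in> carrier G"
  shows "a g = a \<one>"
proof -
  have pos: "\<And>k. k \<in> carrier G \<Longrightarrow> 0 \<le> w k" and gen: "generate G {g \<in> carrier G. w g \<noteq> 0} = carrier G"
    using w by (auto simp: irreducible_weight_def weight_def)
  define W where "W = sum w (carrier G)"
  define S where "S = (\<Sum>g\<in>carrier G. (a g)\<^sup>2)"
  have inv': "(\<Sum>k\<in>carrier G. w k * a (g \<otimes> inv k)) = W * a g" if "g \<in> carrier G" for g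
    using inv[OF that] sum_left_division[OF that, of "\<lambda>h k. a h * w k"]
    by (simp add: W_def mult.commute)
  have sq: "(\<Sum>g\<in>carrier G. (a (g \<otimes> inv k))\<^sup>2) = S" if "k \<in> carrier G" for k
    using sum_right_translate[of "inv k" "\<lambda>g. (a g)\<^sup>2"] that by (simp add: S_def)
  have "(\<Sum>k\<in>carrier G. w k * (\<Sum>g\<in>carrier G. (a (g \<otimes> inv k) - a g)\<^sup>2)) =
     (\<Sum>k\<in>carrier G. w k * (\<Sum>g\<in>carrier G. (a (g \<otimes> inv k))\<^sup>2)) + (\<Sum>k\<in>carrier G. w k * S)
      - 2 * (\<Sum>k\<in>carrier G. \<Sum>g\<in>carrier G. a g * (w k * a (g \<otimes> inv k)))"
    unfolding sum_distrib_left S_def sum.distrib[symmetric] sum_subtractf[symmetric]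
    by (intro sum.cong refl) (simp add: power2_eq_square algebra_simps)
  also have "(\<Sum>k\<in>carrier G. \<Sum>g\<in>carrier G. a g * (w k * a (g \<otimes> inv k))) =
      (\<Sum>g\<in>carrier G. \<Sum>k\<in>carrier G. a g * (w k * a (g \<otimes> inv k)))" by (rule sum.swap)
  also have "\<dots> = (\<Sum>g\<in>carrier G. a g * (W * a g))"
    by (intro sum.cong refl) (simp add: sum_distrib_left[symmetric] inv')
  also have "\<dots> = W * S" by (simp add: S_def sum_distrib_left power2_eq_square algebra_simps)
  also have "(\<Sum>k\<in>carrier G. w k * (\<Sum>g\<in>carrier G. (a (g \<otimes> inv k))\<^sup>2)) = W * S"
    by (simp add: sq sum_distrib_right W_def cong: sum.cong)
  also have "(\<Sum>k\<in>carrier G. w k * S) = W * S" by (simp add: sum_distrib_right W_def)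
  finally have "(\<Sum>k\<in>carrier G. w k * (\<Sum>g\<in>carrier G. (a (g \<otimes> inv k) - a g)\<^sup>2)) = 0" by simp
  then have z: "w k * (\<Sum>g\<in>carrier G. (a (g \<otimes> inv k) - a g)\<^sup>2) = 0" if "k \<in> carrier G" for k
    using that fin pos by (subst (asm) sum_nonneg_eq_0_iff) (auto intro!: mult_nonneg_nonneg sum_nonneg)
  have step: "a (g \<otimes> inv k) = a g" if "k \<in> carrier G" "w k \<noteq> 0" "g \<in> carrier G" for g k
    using z[OF that(1)] that fin by (simp add: sum_nonneg_eq_0_iff)
  have "k \<in> carrier G \<and> (\<forall>g\<in>carrier G. a (g \<otimes> k) = a g)"
    if "k \<in> generate G {g \<in> carrier G. w g \<noteq> 0}" for k
    using that
  proof (induction rule: generate.induct)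
    case (incl k)
    have "a (g \<otimes> k) = a g" if "g \<in> carrier G" for g
      using step[of k "g \<otimes> k"] incl that by (simp add: group_cancel)
    then show ?case using incl by simp
  next
    case (eng k l)
    then show ?case by (auto simp: m_assoc[symmetric])
  qed (use step in auto)
  then show ?thesis using gen assms(3) by (metis l_one one_closed)
qed

end

section \<open>The law of the walk jointly with its sequence of cosets\<close>

locale walk_on_cosets = finite_group_subgroup G H
  for G :: "('a, 'm) monoid_scheme" (structure) and H +
  fixes w \<alpha> :: "'a \<Rightarrow> real" and M :: "'b measure" and X :: "nat \<Rightarrow> 'b \<Rightarrow> 'a"
  assumes irr: "irreducible_weight G w" and init: "prob_distribution G \<alpha>"
    and mc: "is_MC G \<alpha> w M X"
begin

definition total_weight :: real where "total_weight = sum w (carrier G)"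

abbreviation step where "step \<equiv> galg_of G w"

abbreviation avg where "avg \<equiv> eta G H"

definition law :: "nat \<Rightarrow> 'a \<Rightarrow> real" where
  "law t g = \<P>(\<omega> in M. X t \<omega> = g)"

definition path_prob :: "nat \<Rightarrow> (nat \<Rightarrow> 'a set) \<Rightarrow> real" where
  "path_prob t c = \<P>(\<omega> in M. \<forall>i\<le>t. coset (X i \<omega>) = c i)"

definition joint_prob :: "nat \<Rightarrow> (nat \<Rightarrow> 'a set) \<Rightarrow> 'a \<Rightarrow> real" where
  "joint_prob t c g = \<P>(\<omega> in M. X t \<omega> = g \<and> (\<forall>i\<le>t. coset (X i \<omega>) = c i))"

definition hist :: "nat \<Rightarrow> (nat \<Rightarrow> 'a set) \<Rightarrow> 'a \<Rightarrow> complex" where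
  "hist t c = galg_of G (joint_prob t c)"

definition flow :: "'a \<Rightarrow> 'a set \<Rightarrow> real" where
  "flow h K = (\<Sum>k\<in>carrier G. if coset k = K then w (inv h \<otimes> k) else 0)"

text \<open>Transition probabilities between cosets for a walker uniformly distributed in the current coset.\<close>

definition uniform_kernel :: "'a set \<Rightarrow> 'a set \<Rightarrow> real" where
  "uniform_kernel K K' = (\<Sum>h\<in>carrier G. if coset h = K then flow h K' else 0) / (card H * total_weight)"

lemma w_nonneg: "g \<in> carrier G \<Longrightarrow> 0 \<le> w g"
  using irr by (auto simp: irreducible_weight_def weight_def)

lemma total_weight_pos: "total_weight > 0"
proof -
  obtain g where "g \<in> carrier G" "w g \<noteq> 0" using irr by (auto simp: irreducible_weight_def weight_def)
  then show ?thesis unfolding total_weight_def using fin w_nonneg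
    by (intro sum_pos2[of _ g]) (auto simp: less_le)
qed

lemma walk_markov_chain: "markov_chain M (carrier G) (\<lambda>x y. w (inv x \<otimes> y) / total_weight) X"
  using mc by (simp add: is_MC_def total_weight_def)

sublocale prob_space M using walk_markov_chain by (simp add: markov_chain_def)

lemma X_meas: "X t \<in> measurable M (count_space (carrier G))"
  using walk_markov_chain by (simp add: markov_chain_def)

lemma X_closed: "\<omega> \<in> space M \<Longrightarrow> X t \<omega> \<in> carrier G"
  using measurable_space[OF X_meas] by simp

lemma X_event: "{\<omega>\<in>space M. Q (X i \<omega>)} \<in> sets M"
proof -
  have "X i -` {g\<in>carrier G. Q g} \<inter> space M \<in> sets M" by (rule measurable_sets[OF X_meas]) auto
  moreover have "X i -` {g\<in>carrier G. Q g} \<inter> space M = {\<omega>\<in>space M. Q (X i \<omega>)}"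
    using X_closed by auto
  ultimately show ?thesis by simp
qed

lemma path_event: "{\<omega>\<in>space M. \<forall>i\<le>t. coset (X i \<omega>) = c i} \<in> sets M"
proof -
  have "{\<omega>\<in>space M. coset (X i \<omega>) = c i} \<in> sets M" for i
    by (rule X_event[of "\<lambda>x. coset x = c i"])
  then have "{\<omega>\<in>space M. \<forall>i\<in>{..t}. coset (X i \<omega>) = c i} \<in> sets M"
    by (rule sets.sets_Collect_finite_All) (rule finite_atMost)
  then show ?thesis by (simp only: atMost_iff Ball_def)
qed

lemma prob_split:
  assumes "{\<omega>\<in>space M. R \<omega>} \<in> sets M"
  shows "\<P>(\<omega> in M. R \<omega>) = (\<Sum>g\<in>carrier G. \<P>(\<omega> in M. X t \<omega> = g \<and> R \<omega>))"
proof -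
  have "{\<omega>\<in>space M. R \<omega>} = (\<Union>g\<in>carrier G. {\<omega>\<in>space M. X t \<omega> = g \<and> R \<omega>})"
    using X_closed by auto
  moreover have "{\<omega>\<in>space M. X t \<omega> = g \<and> R \<omega>} \<in> sets M" for g
    using sets.sets_Collect_conj[OF assms X_event[of "\<lambda>x. x = g" t]] .
  ultimately show ?thesis using fin
    by (simp only:, intro finite_measure_finite_Union) (auto simp: disjoint_family_on_def)
qed

lemma joint_prob_0:
  assumes "g \<in> carrier G"
  shows "joint_prob 0 c g = (if coset g = c 0 then \<alpha> g else 0)"
proof -
  have "{\<omega>\<in>space M. X 0 \<omega> = g \<and> (\<forall>i\<le>0. coset (X i \<omega>) = c i)} =
      (if coset g = c 0 then {\<omega>\<in>space M. X 0 \<omega> = g} else {})" by auto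
  then show ?thesis using mc assms by (simp add: joint_prob_def is_MC_def)
qed

lemma joint_prob_Suc:
  assumes g: "g \<in> carrier G"
  shows "joint_prob (Suc t) c g =
    (if coset g = c (Suc t) then (\<Sum>h\<in>carrier G. joint_prob t c h * w (inv h \<otimes> g)) / total_weight else 0)"
proof (cases "coset g = c (Suc t)")
  case True
  let ?R = "\<lambda>\<omega>. X (Suc t) \<omega> = g \<and> (\<forall>i\<le>t. coset (X i \<omega>) = c i)"
  have "joint_prob (Suc t) c g = \<P>(\<omega> in M. ?R \<omega>)"
    unfolding joint_prob_def using True by (intro arg_cong[where f="measure M"]) (auto simp: le_Suc_eq)
  also have "\<dots> = (\<Sum>h\<in>carrier G. \<P>(\<omega> in M. X t \<omega> = h \<and> ?R \<omega>))"
    by (rule prob_split[OF sets.sets_Collect_conj[OF path_event X_event[of "\<lambda>x. x = g" "Suc t"]]])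
  also have "\<dots> = (\<Sum>h\<in>carrier G. joint_prob t c h * (w (inv h \<otimes> g) / total_weight))"
  proof (rule sum.cong)
    fix h assume h: "h \<in> carrier G"
    have "\<P>(\<omega> in M. X t \<omega> = h \<and> ?R \<omega>) =
        \<P>(\<omega> in M. X (Suc t) \<omega> = g \<and> X t \<omega> = h \<and> (\<forall>i\<le>t. coset (X i \<omega>) = c i))"
      by (intro arg_cong[where f="measure M"]) auto
    also have "\<dots> = joint_prob t c h * (w (inv h \<otimes> g) / total_weight)"
      unfolding joint_prob_def
      by (rule markov_chain_history[OF walk_markov_chain h g, of t "\<lambda>i x. coset x = c i"])
    finally show "\<P>(\<omega> in M. X t \<omega> = h \<and> ?R \<omega>) = joint_prob t c h * (w (inv h \<otimes> g) / total_weight)" .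
  qed simp
  finally show ?thesis using True by (simp add: sum_divide_distrib)
next
  case False
  then have "{\<omega>\<in>space M. X (Suc t) \<omega> = g \<and> (\<forall>i\<le>Suc t. coset (X i \<omega>) = c i)} = {}" by auto
  then show ?thesis using False unfolding joint_prob_def by (simp only: measure_empty if_False)
qed

lemma two_steps:
  assumes "h \<in> carrier G" "g \<in> carrier G"
  shows "\<P>(\<omega> in M. X (Suc t) \<omega> = g \<and> X t \<omega> = h) = law t h * (w (inv h \<otimes> g) / total_weight)"
  using markov_chain_history[OF walk_markov_chain assms, of t "\<lambda>_ _. True"]
  unfolding law_def by (simp only: simp_thms)

lemma law_Suc:
  assumes g: "g \<in> carrier G"
  shows "law (Suc t) g = (\<Sum>h\<in>carrier G. law t h * w (inv h \<otimes> g)) / total_weight"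
proof -
  have "law (Suc t) g = (\<Sum>h\<in>carrier G. \<P>(\<omega> in M. X t \<omega> = h \<and> X (Suc t) \<omega> = g))"
    unfolding law_def by (rule prob_split[OF X_event[of "\<lambda>x. x = g" "Suc t"]])
  also have "\<dots> = (\<Sum>h\<in>carrier G. law t h * (w (inv h \<otimes> g) / total_weight))"
  proof (rule sum.cong)
    fix h assume h: "h \<in> carrier G"
    have "\<P>(\<omega> in M. X t \<omega> = h \<and> X (Suc t) \<omega> = g) = \<P>(\<omega> in M. X (Suc t) \<omega> = g \<and> X t \<omega> = h)"
      by (intro arg_cong[where f="measure M"]) auto
    also have "\<dots> = law t h * (w (inv h \<otimes> g) / total_weight)" by (rule two_steps[OF h g])
    finally show "\<P>(\<omega> in M. X t \<omega> = h \<and> X (Suc t) \<omega> = g) = law t h * (w (inv h \<otimes> g) / total_weight)" .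
  qed simp
  finally show ?thesis by (simp add: sum_divide_distrib)
qed

lemma sum_law: "(\<Sum>g\<in>carrier G. law t g) = 1"
proof -
  have "1 = \<P>(\<omega> in M. True)" using prob_space by simp
  also have "\<dots> = (\<Sum>g\<in>carrier G. \<P>(\<omega> in M. X t \<omega> = g \<and> True))" by (rule prob_split) simp
  finally show ?thesis by (simp add: law_def)
qed

lemma sum_joint_prob: "(\<Sum>g\<in>carrier G. joint_prob t c g) = path_prob t c"
  unfolding joint_prob_def path_prob_def by (rule prob_split[OF path_event[of t c], of t, symmetric])

lemma hist_closed [simp]: "hist t c \<in> carrier (group_algebra G)" by (simp add: hist_def)

lemma hist_apply: "g \<in> carrier G \<Longrightarrow> hist t c g = of_real (joint_prob t c g)"
  by (simp add: hist_def galg_of_def)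

lemma step_apply: "g \<in> carrier G \<Longrightarrow> step g = of_real (w g)"
  by (simp add: galg_of_def)

lemma hist_0: "hist 0 c = coset_part (c 0) (galg_of G \<alpha>)"
  by (rule galg_ext) (simp_all add: hist_apply joint_prob_0 coset_part_def, simp add: galg_of_def)

lemma hist_Suc: "hist (Suc t) c = coset_part (c (Suc t)) (smult (1 / total_weight) (hist t c \<diamondop> step))"
  by (rule galg_ext)
    (auto simp: hist_apply joint_prob_Suc coset_part_def smult_def conv_apply step_apply)

lemma aug_hist: "aug (hist t c) = path_prob t c"
  unfolding aug_def sum_joint_prob[symmetric] of_real_sum by (intro sum.cong refl) (rule hist_apply)

lemma hist_supported: "coset_part (c t) (hist t c) = hist t c"
proof -
  have "coset_part K (coset_part K x) = coset_part K x" for K x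
    by (rule galg_ext) (auto simp: coset_part_def)
  then show ?thesis by (cases t) (simp_all add: hist_0 hist_Suc)
qed

lemma hist_cong:
  assumes "\<And>i. i \<le> t \<Longrightarrow> c i = c' i"
  shows "hist t c = hist t c'"
proof -
  have "(\<forall>i\<le>t. coset (X i \<omega>) = c i) \<longleftrightarrow> (\<forall>i\<le>t. coset (X i \<omega>) = c' i)" for \<omega>
    using assms by simp
  then show ?thesis unfolding hist_def joint_prob_def by simp
qed

section \<open>Weak lumping as an identity in the group algebra\<close>

lemma conv_step_avg_apply:
  assumes g: "g \<in> carrier G"
  shows "(y \<diamondop> step \<diamondop> avg) g = (\<Sum>h\<in>carrier G. y h * of_real (flow h (coset g))) / card H"
proof -
  have "(\<Sum>k\<in>carrier G. if coset k = coset g then (y \<diamondop> step) k else 0) =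
      (\<Sum>k\<in>carrier G. \<Sum>h\<in>carrier G. if coset k = coset g then y h * of_real (w (inv h \<otimes> k)) else 0)"
    by (intro sum.cong refl) (simp add: conv_apply step_apply)
  also have "\<dots> =
      (\<Sum>h\<in>carrier G. \<Sum>k\<in>carrier G. if coset k = coset g then y h * of_real (w (inv h \<otimes> k)) else 0)"
    by (rule sum.swap)
  also have "\<dots> = (\<Sum>h\<in>carrier G. y h * of_real (flow h (coset g)))"
    unfolding flow_def of_real_sum sum_distrib_left by (intro sum.cong refl) simp
  finally show ?thesis by (simp add: conv_eta_apply[OF g])
qed

text \<open>The next two lemmas translate between probabilities and the algebra: the first product contains the
  true probabilities of the next coset, the second those under uniform distribution in the
  current coset.\<close>

lemma hist_step_avg_apply:
  assumes g: "g \<in> carrier G"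
  shows "(hist t c \<diamondop> step \<diamondop> avg) g =
    of_real (total_weight / card H * path_prob (Suc t) (c(Suc t := coset g)))"
proof -
  let ?c = "c(Suc t := coset g)"
  have h: "hist t ?c = hist t c" by (rule hist_cong) auto
  have "of_real (path_prob (Suc t) ?c) = aug (hist (Suc t) ?c)" by (simp add: aug_hist)
  also have "\<dots> = (\<Sum>k\<in>carrier G. (if coset k = coset g then (hist t c \<diamondop> step) k else 0) / total_weight)"
    unfolding aug_def by (intro sum.cong refl) (simp add: hist_Suc h coset_part_def smult_def)
  also have "\<dots> = (hist t c \<diamondop> step \<diamondop> avg) g * card H / total_weight"
    using cardH by (simp add: conv_eta_apply[OF g] sum_divide_distrib[symmetric])
  finally show ?thesis using cardH total_weight_pos by (simp add: field_simps)
qed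

lemma avg_step_avg_apply:
  assumes x: "coset_part K x = x" and g: "g \<in> carrier G"
  shows "(x \<diamondop> avg \<diamondop> step \<diamondop> avg) g = total_weight / card H * aug x * uniform_kernel K (coset g)"
proof -
  have "(\<Sum>h\<in>carrier G. (x \<diamondop> avg) h * of_real (flow h (coset g))) =
      (\<Sum>h\<in>carrier G. aug x / card H * of_real (if coset h = K then flow h (coset g) else 0))"
    by (intro sum.cong refl) (simp add: conv_eta_supported[OF x])
  also have "\<dots> = aug x / card H * (card H * total_weight * uniform_kernel K (coset g))"
    unfolding sum_distrib_left[symmetric] of_real_sum[symmetric]
    using cardH total_weight_pos by (simp add: uniform_kernel_def)
  finally show ?thesis using cardH by (simp add: conv_step_avg_apply[OF g])
qed

lemma flow_nonneg: "h \<in> carrier G \<Longrightarrow> 0 \<le> flow h K"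
  unfolding flow_def by (intro sum_nonneg) (simp add: w_nonneg)

lemma sum_flow: "h \<in> carrier G \<Longrightarrow> (\<Sum>K\<in>lcosets H. flow h K) = total_weight"
  unfolding flow_def total_weight_def by (simp add: sum_over_cosets sum_left_translate)

lemma uniform_kernel_stochastic: "stochastic_matrix (lcosets H) uniform_kernel"
proof -
  have "(\<Sum>K'\<in>lcosets H. uniform_kernel K K') = 1" if K: "K \<in> lcosets H" for K
  proof -
    obtain k where k: "k \<in> carrier G" "K = coset k" using K by (rule lcosetsE)
    have "(\<Sum>K'\<in>lcosets H. uniform_kernel K K') =
        (\<Sum>h\<in>carrier G. \<Sum>K'\<in>lcosets H. if coset h = K then flow h K' else 0) / (card H * total_weight)"
      unfolding uniform_kernel_def sum_divide_distrib[symmetric] by (subst sum.swap) simp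
    also have "(\<Sum>h\<in>carrier G. \<Sum>K'\<in>lcosets H. if coset h = K then flow h K' else 0) =
        (\<Sum>h\<in>carrier G. if coset h = K then total_weight else 0)"
      by (intro sum.cong refl) (simp add: sum_flow)
    also have "\<dots> = card H * total_weight"
      using fin card_coset[OF k(1)] by (simp add: sum.inter_filter[symmetric] k(2))
    finally show ?thesis using cardH total_weight_pos by simp
  qed
  moreover have "0 \<le> uniform_kernel K K'" for K K'
    unfolding uniform_kernel_def using total_weight_pos
    by (intro divide_nonneg_nonneg sum_nonneg) (simp_all add: flow_nonneg)
  ultimately show ?thesis by (simp add: stochastic_matrix_def)
qed

text \<open>By compactness the time averages \<open>A N\<close> of the laws have a convergent subsequence. Its limit is
  invariant under the walk, as a step changes the values of \<open>A N\<close> by at most \<open>1 / (N + 1)\<close>, so it is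
  uniform. Averages are needed because the laws themselves need not converge when the walk is
  periodic.\<close>

lemma uniform_limit_of_laws:
  fixes \<phi> :: "'a \<Rightarrow> real"
  assumes van: "\<And>t. (\<Sum>g\<in>carrier G. law t g * \<phi> g) = 0"
  shows "(\<Sum>g\<in>carrier G. \<phi> g) = 0"
proof -
  define A where "A N g = (\<Sum>t<Suc N. law t g) / Suc N" for N g
  have law01: "0 \<le> law t g" "law t g \<le> 1" for t g by (simp_all add: law_def)
  have "A N g \<in> {0..1}" for N g
  proof -
    have "(\<Sum>t<Suc N. law t g) \<le> (\<Sum>t<Suc N. 1)" by (intro sum_mono law01)
    moreover have "0 \<le> (\<Sum>t<Suc N. law t g)" by (intro sum_nonneg law01)
    ultimately show ?thesis by (simp add: A_def divide_le_eq)
  qed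
  then obtain r where r: "strict_mono r" "\<forall>g\<in>carrier G. convergent (\<lambda>n. A (r n) g)"
    using convergent_subsequence_on_finite_set[OF fin] by blast
  define a where "a g = lim (\<lambda>n. A (r n) g)" for g
  have a: "(\<lambda>n. A (r n) g) \<longlonglongrightarrow> a g" if "g \<in> carrier G" for g
    using r(2) that by (simp add: a_def convergent_LIMSEQ_iff)
  have A_lin: "(\<Sum>g\<in>carrier G. A N g * \<psi> g) = (\<Sum>t<Suc N. \<Sum>g\<in>carrier G. law t g * \<psi> g) / Suc N"
    for N and \<psi> :: "'a \<Rightarrow> real"
  proof -
    have "(\<Sum>g\<in>carrier G. A N g * \<psi> g) = (\<Sum>g\<in>carrier G. \<Sum>t<Suc N. law t g * \<psi> g) / Suc N"
      unfolding A_def sum_divide_distrib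
      by (simp add: sum_distrib_right sum_divide_distrib del: sum.lessThan_Suc)
    then show ?thesis by (subst (asm) sum.swap)
  qed
  have a_lim: "(\<lambda>n. \<Sum>g\<in>carrier G. A (r n) g * \<psi> g) \<longlonglongrightarrow> (\<Sum>g\<in>carrier G. a g * \<psi> g)" for \<psi>
    by (intro tendsto_sum tendsto_mult tendsto_const a)
  have a1: "(\<Sum>g\<in>carrier G. a g * 1) = 1"
  proof -
    have "(\<Sum>g\<in>carrier G. A N g * 1) = 1" for N
      unfolding A_lin by (simp add: sum_law del: sum.lessThan_Suc)
    then show ?thesis using a_lim[of "\<lambda>_. 1"] LIMSEQ_unique tendsto_const by (metis (no_types, lifting) ext)
  qed
  have a\<phi>: "(\<Sum>g\<in>carrier G. a g * \<phi> g) = 0"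
    using a_lim[of \<phi>] by (simp add: A_lin van LIMSEQ_const_iff del: sum.lessThan_Suc)
  have inv: "(\<Sum>h\<in>carrier G. a h * w (inv h \<otimes> g)) = sum w (carrier G) * a g" if g: "g \<in> carrier G" for g
  proof -
    have diff: "(\<Sum>h\<in>carrier G. A N h * w (inv h \<otimes> g)) - total_weight * A N g =
        total_weight * ((law (Suc N) g - law 0 g) / Suc N)" for N
    proof -
      have "(\<Sum>h\<in>carrier G. A N h * w (inv h \<otimes> g)) = (\<Sum>t<Suc N. total_weight * law (Suc t) g) / Suc N"
        unfolding A_lin using total_weight_pos by (simp add: law_Suc[OF g] del: sum.lessThan_Suc)
      moreover have "(\<Sum>t<Suc N. law (Suc t) g) - (\<Sum>t<Suc N. law t g) = law (Suc N) g - law 0 g"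
        unfolding sum_subtractf[symmetric] by (rule sum_lessThan_telescope)
      ultimately show ?thesis
        by (simp add: A_def sum_distrib_left[symmetric] diff_divide_distrib[symmetric]
            right_diff_distrib[symmetric] del: sum.lessThan_Suc)
    qed
    have "(\<lambda>N. (law (Suc N) g - law 0 g) / Suc N) \<longlonglongrightarrow> 0"
    proof (rule Lim_null_comparison)
      have "\<bar>law (Suc N) g - law 0 g\<bar> \<le> 1" for N using law01[of "Suc N" g] law01[of 0 g] by linarith
      then show "\<forall>\<^sub>F N in sequentially. norm ((law (Suc N) g - law 0 g) / Suc N) \<le> inverse (real (Suc N))"
        by (simp add: divide_simps)
    qed (rule LIMSEQ_inverse_real_of_nat)
    then have "(\<lambda>N. total_weight * ((law (Suc N) g - law 0 g) / Suc N)) \<longlonglongrightarrow> total_weight * 0"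
      by (intro tendsto_intros)
    then have "(\<lambda>n. (\<Sum>h\<in>carrier G. A (r n) h * w (inv h \<otimes> g)) - total_weight * A (r n) g) \<longlonglongrightarrow> 0"
      unfolding diff using LIMSEQ_subseq_LIMSEQ[OF _ r(1)] by (force simp: o_def)
    moreover have "(\<lambda>n. (\<Sum>h\<in>carrier G. A (r n) h * w (inv h \<otimes> g)) - total_weight * A (r n) g)
        \<longlonglongrightarrow> (\<Sum>h\<in>carrier G. a h * w (inv h \<otimes> g)) - total_weight * a g"
      by (intro tendsto_diff a_lim tendsto_mult tendsto_const a g)
    ultimately show ?thesis using LIMSEQ_unique unfolding total_weight_def by fastforce
  qed
  have const: "a g = a \<one>" if "g \<in> carrier G" for g
    using harmonic_constant[OF irr inv that] .
  have sum_a: "(\<Sum>g\<in>carrier G. a g * \<psi> g) = a \<one> * (\<Sum>g\<in>carrier G. \<psi> g)" for \<psi>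
    unfolding sum_distrib_left by (intro sum.cong refl arg_cong2[where f="(*)"] const)
  then have "a \<one> \<noteq> 0" using a1 sum_a[of "\<lambda>_. 1"] by auto
  then show ?thesis using a\<phi> sum_a by simp
qed

lemma law_coset_sum: 
  "\<P>(\<omega> in M. coset (X t \<omega>) = K) = (\<Sum>h\<in>carrier G. law t h * (if coset h = K then 1 else 0))"
proof -
  have "\<P>(\<omega> in M. X t \<omega> = h \<and> coset (X t \<omega>) = K) = law t h * (if coset h = K then 1 else 0)" for h
  proof -
    have "{\<omega>\<in>space M. X t \<omega> = h \<and> coset (X t \<omega>) = K} = (if coset h = K then {\<omega>\<in>space M. X t \<omega> = h} else {})"
      by auto
    then show ?thesis by (simp add: law_def)
  qed
  then show ?thesis using prob_split[OF X_event[of "\<lambda>x. coset x = K" t], of t] by simp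
qed

lemma law_two_cosets:
  "\<P>(\<omega> in M. coset (X (Suc t) \<omega>) = K' \<and> coset (X t \<omega>) = K) =
    (\<Sum>h\<in>carrier G. law t h * (if coset h = K then flow h K' / total_weight else 0))"
proof -
  have one: "\<P>(\<omega> in M. X (Suc t) \<omega> = k \<and> (X t \<omega> = h \<and> coset (X (Suc t) \<omega>) = K' \<and> coset (X t \<omega>) = K)) =
      (if coset h = K \<and> coset k = K' then law t h * w (inv h \<otimes> k) / total_weight else 0)"
    if "h \<in> carrier G" "k \<in> carrier G" for h k
  proof -
    have "{\<omega>\<in>space M. X (Suc t) \<omega> = k \<and> (X t \<omega> = h \<and> coset (X (Suc t) \<omega>) = K' \<and> coset (X t \<omega>) = K)} =
      (if coset h = K \<and> coset k = K' then {\<omega>\<in>space M. X (Suc t) \<omega> = k \<and> X t \<omega> = h} else {})" by auto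
    then show ?thesis using two_steps[OF that, of t] 
      by (cases "coset h = K \<and> coset k = K'")
        (simp_all only: measure_empty times_divide_eq_right if_True if_False simp_thms)
  qed
  have ev: "{\<omega>\<in>space M. coset (X (Suc t) \<omega>) = K' \<and> coset (X t \<omega>) = K} \<in> sets M"
    using sets.sets_Collect_conj[OF X_event[of "\<lambda>x. coset x = K" t]
        X_event[of "\<lambda>x. coset x = K'" "Suc t"]] .
  have "\<P>(\<omega> in M. coset (X (Suc t) \<omega>) = K' \<and> coset (X t \<omega>) = K) =
     (\<Sum>h\<in>carrier G. \<P>(\<omega> in M. X t \<omega> = h \<and> coset (X (Suc t) \<omega>) = K' \<and> coset (X t \<omega>) = K))"
    by (rule prob_split[OF ev])
  also have "\<dots> = (\<Sum>h\<in>carrier G. \<Sum>k\<in>carrier G.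
      \<P>(\<omega> in M. X (Suc t) \<omega> = k \<and> (X t \<omega> = h \<and> coset (X (Suc t) \<omega>) = K' \<and> coset (X t \<omega>) = K)))"
    by (rule sum.cong[OF refl])
      (rule prob_split[OF sets.sets_Collect_conj[OF ev X_event[of "\<lambda>x. x = _" t]]])
  also have "\<dots> = (\<Sum>h\<in>carrier G. law t h * (if coset h = K then flow h K' / total_weight else 0))"
    unfolding flow_def
    by (intro sum.cong refl) 
      (auto simp: one sum_distrib_left sum_divide_distrib intro!: sum.cong cong: if_cong sum.cong)
  finally show ?thesis .
qed

text \<open>For every \<open>t\<close> the probability of being in \<open>K\<close> at time \<open>t\<close> and in \<open>K'\<close> one step later can be computed from
  the law of \<open>X\<^sub>t\<close>, and by the Markov property it is \<open>P K K'\<close> times the probability of \<open>K\<close>. This is a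
  linear equation in the law, so it holds for the uniform distribution as well.\<close>

lemma lumped_kernel_unique:
  assumes P: "markov_chain M (lcosets H) P (\<lambda>t \<omega>. coset (X t \<omega>))"
    and K: "K \<in> lcosets H" "K' \<in> lcosets H"
  shows "P K K' = uniform_kernel K K'"
proof -
  define \<phi> where "\<phi> h = (if coset h = K then flow h K' / total_weight - P K K' else 0)" for h
  have "(\<Sum>g\<in>carrier G. law t g * \<phi> g) = 0" for t
  proof -
    have "(\<Sum>h\<in>carrier G. law t h * (if coset h = K then flow h K' / total_weight else 0)) =
        (\<Sum>h\<in>carrier G. law t h * (if coset h = K then 1 else 0)) * P K K'"
      using markov_chain_history[OF P K, of t "\<lambda>_ _. True"]
      unfolding law_two_cosets[symmetric] law_coset_sum[symmetric] by simp
    then have "0 = (\<Sum>h\<in>carrier G. law t h * (if coset h = K then flow h K' / total_weight else 0)) -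
        (\<Sum>h\<in>carrier G. law t h * (if coset h = K then 1 else 0)) * P K K'" by simp
    also have "\<dots> = (\<Sum>g\<in>carrier G. law t g * \<phi> g)"
      unfolding sum_distrib_right sum_subtractf[symmetric]
      by (intro sum.cong refl) (simp add: \<phi>_def algebra_simps)
    finally show ?thesis by simp
  qed
  then have "0 = (\<Sum>g\<in>carrier G. \<phi> g)" using uniform_limit_of_laws[of \<phi>] by simp
  also have "\<dots> = (\<Sum>h\<in>carrier G. (if coset h = K then flow h K' else 0) / total_weight) -
      (\<Sum>h\<in>carrier G. if coset h = K then P K K' else 0)"
    unfolding sum_subtractf[symmetric] by (intro sum.cong refl) (simp add: \<phi>_def)
  also have "(\<Sum>h\<in>carrier G. (if coset h = K then flow h K' else 0) / total_weight) = card H * uniform_kernel K K'"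
    using cardH by (simp add: uniform_kernel_def sum_divide_distrib[symmetric])
  also have "(\<Sum>h\<in>carrier G. if coset h = K then P K K' else 0) = card H * P K K'"
  proof -
    obtain k where k: "k \<in> carrier G" "K = coset k" using K(1) by (rule lcosetsE)
    show ?thesis using fin card_coset[OF k(1)] by (simp add: sum.inter_filter[symmetric] k(2))
  qed
  finally show ?thesis using cardH by simp
qed

lemma path_prob_Suc:
  "path_prob (Suc t) c = \<P>(\<omega> in M. coset (X (Suc t) \<omega>) = c (Suc t) \<and> (\<forall>i\<le>t. coset (X i \<omega>) = c i))"
  unfolding path_prob_def by (intro arg_cong[where f="measure M"]) (auto simp: le_Suc_eq)

text \<open>Weak lumping concerns sequences of cosets only. For other sequences both sides of the equations
  below are zero, so these can be stated for all sequences of sets.\<close>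

lemma path_prob_outside: "i \<le> t \<Longrightarrow> c i \<notin> lcosets H \<Longrightarrow> path_prob t c = 0"
proof -
  assume i: "i \<le> t" "c i \<notin> lcosets H"
  have "\<not> (\<forall>j\<le>t. coset (X j \<omega>) = c j)" if "\<omega> \<in> space M" for \<omega>
    using i coset_in_lcosets[OF X_closed[OF that, of i]] by auto
  then have "{\<omega>\<in>space M. \<forall>i\<le>t. coset (X i \<omega>) = c i} = {}" by blast
  then show ?thesis unfolding path_prob_def by (simp only: measure_empty)
qed

lemma uniform_kernel_outside: "K' \<notin> lcosets H \<Longrightarrow> uniform_kernel K K' = 0"
proof -
  assume "K' \<notin> lcosets H"
  then have "flow h K' = 0" for h unfolding flow_def using coset_in_lcosets by (intro sum.neutral) auto
  then show ?thesis by (simp add: uniform_kernel_def cong: if_cong)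
qed

lemma lumps_weakly_iff_path_prob:
  "lumps_weakly G H M X \<longleftrightarrow> (\<forall>t c. path_prob (Suc t) c = path_prob t c * uniform_kernel (c t) (c (Suc t)))"
proof
  assume "lumps_weakly G H M X"
  then obtain P where P: "markov_chain M (lcosets H) P (\<lambda>t \<omega>. coset (X t \<omega>))"
    by (auto simp: lumps_weakly_def)
  show "\<forall>t c. path_prob (Suc t) c = path_prob t c * uniform_kernel (c t) (c (Suc t))"
  proof (intro allI)
    fix t c
    show "path_prob (Suc t) c = path_prob t c * uniform_kernel (c t) (c (Suc t))"
    proof (cases "\<forall>i\<le>Suc t. c i \<in> lcosets H")
      case True
      have "path_prob t c = \<P>(\<omega> in M. coset (X t \<omega>) = c t \<and> (\<forall>i\<le>t. coset (X i \<omega>) = c i))"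
        unfolding path_prob_def by (intro arg_cong[where f="measure M"]) auto
      moreover have "path_prob (Suc t) c = \<P>(\<omega> in M. coset (X (Suc t) \<omega>) = c (Suc t) \<and>
          coset (X t \<omega>) = c t \<and> (\<forall>i\<le>t. coset (X i \<omega>) = c i))"
        unfolding path_prob_Suc by (intro arg_cong[where f="measure M"]) auto
      ultimately show ?thesis
        using markov_chain_history[OF P, of "c t" "c (Suc t)" t "\<lambda>i x. x = c i"]
          lumped_kernel_unique[OF P] True by simp
    next
      case False
      then obtain i where "i \<le> Suc t" "c i \<notin> lcosets H" by blast
      then show ?thesis using path_prob_outside[of i "Suc t" c] path_prob_outside[of i t c]
          uniform_kernel_outside by (cases "i = Suc t") auto
    qed
  qed
next
  assume R: "\<forall>t c. path_prob (Suc t) c = path_prob t c * uniform_kernel (c t) (c (Suc t))"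
  have "markov_chain M (lcosets H) uniform_kernel (\<lambda>t \<omega>. coset (X t \<omega>))"
    unfolding markov_chain_def
  proof (intro conjI allI impI)
    fix t
    show "(\<lambda>\<omega>. coset (X t \<omega>)) \<in> measurable M (count_space (lcosets H))"
      by (rule measurable_compose[OF X_meas]) (auto simp: coset_in_lcosets)
  next
    fix t s
    assume "(\<forall>i\<le>Suc t. s i \<in> lcosets H) \<and> \<P>(\<omega> in M. \<forall>i\<le>t. coset (X i \<omega>) = s i) > 0"
    then have "path_prob t s > 0" by (simp add: path_prob_def)
    then show "\<P>(\<omega> in M. coset (X (Suc t) \<omega>) = s (Suc t) \<bar> \<forall>i\<le>t. coset (X i \<omega>) = s i) =
        uniform_kernel (s t) (s (Suc t))"
      using R[rule_format, of t s] unfolding cond_prob_def path_prob_Suc[symmetric] path_prob_def[symmetric]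
      by simp
  qed (simp_all add: prob_space_axioms finite_lcosets uniform_kernel_stochastic)
  then show "lumps_weakly G H M X" by (auto simp: lumps_weakly_def)
qed

theorem lumps_weakly_iff:
  "lumps_weakly G H M X \<longleftrightarrow> (\<forall>t c. hist t c \<diamondop> step \<diamondop> avg = hist t c \<diamondop> avg \<diamondop> step \<diamondop> avg)"
  unfolding lumps_weakly_iff_path_prob
proof
  assume R: "\<forall>t c. path_prob (Suc t) c = path_prob t c * uniform_kernel (c t) (c (Suc t))"
  show "\<forall>t c. hist t c \<diamondop> step \<diamondop> avg = hist t c \<diamondop> avg \<diamondop> step \<diamondop> avg"
  proof (intro allI, rule galg_ext)
    fix t c g assume g: "g \<in> carrier G"
    have "path_prob t (c(Suc t := coset g)) = path_prob t c" by (simp add: path_prob_def)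
    then show "(hist t c \<diamondop> step \<diamondop> avg) g = (hist t c \<diamondop> avg \<diamondop> step \<diamondop> avg) g"
      using R[rule_format, of t "c(Suc t := coset g)"]
      by (simp add: hist_step_avg_apply[OF g] avg_step_avg_apply[OF hist_supported g] aug_hist)
  qed simp_all
next
  assume R: "\<forall>t c. hist t c \<diamondop> step \<diamondop> avg = hist t c \<diamondop> avg \<diamondop> step \<diamondop> avg"
  show "\<forall>t c. path_prob (Suc t) c = path_prob t c * uniform_kernel (c t) (c (Suc t))"
  proof (intro allI)
    fix t c
    show "path_prob (Suc t) c = path_prob t c * uniform_kernel (c t) (c (Suc t))"
    proof (cases "c (Suc t) \<in> lcosets H")
      case True
      then obtain g where g: "g \<in> carrier G" "c (Suc t) = coset g" by (rule lcosetsE)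
      then have c: "c(Suc t := coset g) = c" by (metis fun_upd_triv)
      have "(hist t c \<diamondop> step \<diamondop> avg) g = (hist t c \<diamondop> avg \<diamondop> step \<diamondop> avg) g" using R by simp
      then have "of_real (total_weight / card H * path_prob (Suc t) c) =
          (of_real (total_weight / card H * (path_prob t c * uniform_kernel (c t) (c (Suc t)))) :: complex)"
        using g
        by (simp add: hist_step_avg_apply[OF g(1)] avg_step_avg_apply[OF hist_supported g(1)]
            aug_hist c)
      then show ?thesis using total_weight_pos cardH by (simp only: of_real_eq_iff) simp
    qed (simp add: uniform_kernel_outside path_prob_outside[of "Suc t"])
  qed
qed

section \<open>Sufficiency of the idempotent\<close>

definition admissible :: "('a \<Rightarrow> complex) \<Rightarrow> bool" where
  "admissible e \<longleftrightarrow>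
     galg_of G \<alpha> \<in> PIdl\<^bsub>group_algebra G\<^esub> e \<and>
     e \<diamondop> step \<diamondop> (\<one>\<^bsub>group_algebra G\<^esub> \<ominus>\<^bsub>group_algebra G\<^esub> e) = \<zero>\<^bsub>group_algebra G\<^esub> \<and>
     (e \<ominus>\<^bsub>group_algebra G\<^esub> avg) \<diamondop> step \<diamondop> avg = \<zero>\<^bsub>group_algebra G\<^esub>"

lemma E_bullet_iff:
  "e \<in> E_bullet G H \<longleftrightarrow> e \<in> galg_sub G H \<and> e \<diamondop> e = e \<and> avg \<diamondop> e = avg"
  by (simp add: E_bullet_def)

lemma admissible_iff:
  assumes "e \<in> E_bullet G H"
  shows "admissible e \<longleftrightarrow>
    galg_of G \<alpha> \<diamondop> e = galg_of G \<alpha> \<and> e \<diamondop> step \<diamondop> e = e \<diamondop> step \<and> e \<diamondop> step \<diamondop> avg = avg \<diamondop> step \<diamondop> avg"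
proof -
  have e: "e \<in> carrier (group_algebra G)" "e \<diamondop> e = e"
    using assms by (auto simp: E_bullet_iff galg_sub_iff)
  have "e \<diamondop> step \<diamondop> (\<one>\<^bsub>group_algebra G\<^esub> \<ominus>\<^bsub>group_algebra G\<^esub> e) = e \<diamondop> step \<ominus>\<^bsub>group_algebra G\<^esub> e \<diamondop> step \<diamondop> e"
    using e by (simp add: galg.minus_eq galg.r_distr galg.r_minus)
  moreover have "(e \<ominus>\<^bsub>group_algebra G\<^esub> avg) \<diamondop> step \<diamondop> avg =
      e \<diamondop> step \<diamondop> avg \<ominus>\<^bsub>group_algebra G\<^esub> avg \<diamondop> step \<diamondop> avg"
    using e by (simp add: galg.minus_eq galg.l_distr galg.l_minus)
  ultimately show ?thesis
    unfolding admissible_def PIdl_idempotent_iff[OF e]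
    using e galg.r_right_minus_eq[of "e \<diamondop> step" "e \<diamondop> step \<diamondop> e"]
      galg.r_right_minus_eq[of "e \<diamondop> step \<diamondop> avg" "avg \<diamondop> step \<diamondop> avg"]
    by auto
qed

lemma hist_in_ideal:
  assumes e: "e \<in> E_bullet G H" and "admissible e"
  shows "hist t c \<diamondop> e = hist t c"
proof (induction t)
  case 0
  have "e \<in> galg_sub G H" using e by (simp add: E_bullet_iff)
  then show ?case
    using assms by (simp add: hist_0 coset_part_conv[symmetric] admissible_iff)
next
  case (Suc t)
  have eH: "e \<in> galg_sub G H" and eA: "e \<in> carrier (group_algebra G)"
    and ewe: "e \<diamondop> (step \<diamondop> e) = e \<diamondop> step"
    using e assms(2) by (auto simp: E_bullet_iff galg_sub_iff admissible_iff galg.m_assoc)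
  have "hist t c \<diamondop> step \<diamondop> e = hist t c \<diamondop> e \<diamondop> step \<diamondop> e" by (simp only: Suc.IH)
  also have "\<dots> = hist t c \<diamondop> (e \<diamondop> (step \<diamondop> e))" using eA by (simp add: galg.m_assoc)
  also have "\<dots> = hist t c \<diamondop> e \<diamondop> step" using eA by (simp add: ewe galg.m_assoc)
  also have "\<dots> = hist t c \<diamondop> step" by (simp only: Suc.IH)
  finally show ?case
    using eA by (simp add: hist_Suc coset_part_conv[OF eH, symmetric] smult_conv)
qed

lemma lumps_weakly_if_admissible:
  assumes e: "e \<in> E_bullet G H" and "admissible e"
  shows "lumps_weakly G H M X"
  unfolding lumps_weakly_iff
proof (intro allI)
  fix t c
  have eA: "e \<in> carrier (group_algebra G)" and ewa: "e \<diamondop> (step \<diamondop> avg) = avg \<diamondop> (step \<diamondop> avg)"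
    using e assms(2) by (auto simp: E_bullet_iff galg_sub_iff admissible_iff galg.m_assoc)
  have "hist t c \<diamondop> step \<diamondop> avg = hist t c \<diamondop> e \<diamondop> step \<diamondop> avg"
    by (simp only: hist_in_ideal[OF assms])
  also have "\<dots> = hist t c \<diamondop> (e \<diamondop> (step \<diamondop> avg))" using eA by (simp add: galg.m_assoc)
  also have "\<dots> = hist t c \<diamondop> avg \<diamondop> step \<diamondop> avg" by (simp add: ewa galg.m_assoc)
  finally show "hist t c \<diamondop> step \<diamondop> avg = hist t c \<diamondop> avg \<diamondop> step \<diamondop> avg" .
qed

lemma cond_dist_eq: "galg_of G (cond_dist G H M X t c) = smult (1 / path_prob t c) (hist t c)"
  by (rule galg_ext)
    (simp_all add: smult_def hist_apply,
     simp add: galg_of_def cond_dist_def cond_prob_def joint_prob_def path_prob_def)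

lemma cond_dist_in_ideal:
  assumes e: "e \<in> E_bullet G H" and "admissible e"
  shows "galg_of G (cond_dist G H M X t c) \<in> PIdl\<^bsub>group_algebra G\<^esub> e"
proof -
  have eA: "e \<in> carrier (group_algebra G)" "e \<diamondop> e = e"
    using e by (auto simp: E_bullet_iff galg_sub_iff)
  then show ?thesis
    by (simp add: PIdl_idempotent_iff cond_dist_eq smult_conv hist_in_ideal[OF assms])
qed

section \<open>The left ideal generated by the histories\<close>

text \<open>Taking \<open>a\<close> from all of \<open>\<complex>[G]\<close> provides scalar multiples and translates at once. What has to hold on
  the whole ideal is then shown for the generators, by induction.\<close>

inductive_set hist_ideal :: "('a \<Rightarrow> complex) set" where
  zero: "\<zero>\<^bsub>group_algebra G\<^esub> \<in> hist_ideal"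
| add_multiple: "x \<in> hist_ideal \<Longrightarrow> a \<in> carrier (group_algebra G) \<Longrightarrow>
    x \<oplus>\<^bsub>group_algebra G\<^esub> a \<diamondop> hist t c \<in> hist_ideal"

lemma hist_ideal_closed: "x \<in> hist_ideal \<Longrightarrow> x \<in> carrier (group_algebra G)"
  by (induction rule: hist_ideal.induct) auto

lemma hist_ideal_add:
  assumes "y \<in> hist_ideal" "x \<in> hist_ideal"
  shows "x \<oplus>\<^bsub>group_algebra G\<^esub> y \<in> hist_ideal"
  using assms
proof (induction rule: hist_ideal.induct)
  case zero
  then show ?case by (simp add: hist_ideal_closed)
next
  case (add_multiple y a t c)
  then show ?case
    using hist_ideal.add_multiple[of "x \<oplus>\<^bsub>group_algebra G\<^esub> y" a t c]
    by (simp add: hist_ideal_closed galg.a_assoc)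
qed

lemma hist_ideal_left:
  assumes "x \<in> hist_ideal" "b \<in> carrier (group_algebra G)"
  shows "b \<diamondop> x \<in> hist_ideal"
  using assms
proof (induction rule: hist_ideal.induct)
  case zero
  then show ?case by (simp add: hist_ideal.zero)
next
  case (add_multiple y a t c)
  then show ?case
    using hist_ideal.add_multiple[of "b \<diamondop> y" "b \<diamondop> a" t c]
    by (simp add: hist_ideal_closed galg.r_distr galg.m_assoc)
qed

lemma multiple_in_hist_ideal: "a \<in> carrier (group_algebra G) \<Longrightarrow> a \<diamondop> hist t c \<in> hist_ideal"
  using hist_ideal.add_multiple[OF hist_ideal.zero, of a t c] by simp

lemma hist_in_hist_ideal: "hist t c \<in> hist_ideal"
  using multiple_in_hist_ideal[of "\<one>\<^bsub>group_algebra G\<^esub>" t c] by simp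

lemma hist_ideal_sum:
  assumes "finite I" "\<And>i. i \<in> I \<Longrightarrow> f i \<in> hist_ideal"
  shows "(\<lambda>g\<in>carrier G. \<Sum>i\<in>I. f i g) \<in> hist_ideal"
  using assms
proof (induction I rule: finite_induct)
  case empty
  show ?case using hist_ideal.zero by (simp only: group_algebra_simps sum.empty)
next
  case (insert j I)
  have "f j \<oplus>\<^bsub>group_algebra G\<^esub> (\<lambda>g\<in>carrier G. \<Sum>i\<in>I. f i g) \<in> hist_ideal"
    by (intro hist_ideal_add insert.IH insert.prems) simp_all
  moreover have "f j \<oplus>\<^bsub>group_algebra G\<^esub> (\<lambda>g\<in>carrier G. \<Sum>i\<in>I. f i g) =
      (\<lambda>g\<in>carrier G. \<Sum>i\<in>insert j I. f i g)"
    using insert.hyps by (auto simp: group_algebra_simps)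
  ultimately show ?case by (simp only:)
qed

lemma hist_ideal_of_coset_parts:
  assumes x: "x \<in> carrier (group_algebra G)" and parts: "\<And>K. K \<in> lcosets H \<Longrightarrow> coset_part K x \<in> hist_ideal"
  shows "x \<in> hist_ideal"
proof -
  have eq: "x = (\<lambda>g\<in>carrier G. \<Sum>K\<in>lcosets H. coset_part K x g)"
    by (rule galg_ext) (use x in \<open>auto simp: coset_part_def finite_lcosets coset_in_lcosets\<close>)
  show ?thesis by (subst eq) (rule hist_ideal_sum[OF finite_lcosets parts])
qed

text \<open>Each \<open>hist t c\<close> is supported on the single coset \<open>c t\<close>, which a translation by \<open>h\<close> moves
  onto \<open>h c(t)\<close>. Cutting \<open>a \<cdot> hist t c\<close> down to \<open>J\<close> therefore amounts to dropping from \<open>a\<close>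
  all \<open>h\<close> with \<open>h c(t) \<noteq> J\<close>.\<close>

lemma hist_ideal_coset_part:
  assumes "x \<in> hist_ideal"
  shows "coset_part J x \<in> hist_ideal"
  using assms
proof (induction rule: hist_ideal.induct)
  case zero
  have "coset_part J \<zero>\<^bsub>group_algebra G\<^esub> = \<zero>\<^bsub>group_algebra G\<^esub>"
    by (auto simp: coset_part_def group_algebra_simps)
  then show ?case by (simp add: hist_ideal.zero)
next
  case (add_multiple x a t c)
  define a' where "a' = (\<lambda>h\<in>carrier G. if h <# c t = J then a h else 0)"
  have "coset_part J (a \<diamondop> hist t c) = a' \<diamondop> hist t c"
  proof (rule galg_ext)
    fix g assume g: "g \<in> carrier G"
    have mult: "(if coset g = J then a h * hist t c (inv h \<otimes> g) else 0) = a' h * hist t c (inv h \<otimes> g)"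
      if h: "h \<in> carrier G" for h
    proof (cases "coset (inv h \<otimes> g) = c t")
      case True
      then show ?thesis using translate_coset[OF h g True] h by (simp add: a'_def)
    next
      case False
      have "hist t c (inv h \<otimes> g) = coset_part (c t) (hist t c) (inv h \<otimes> g)"
        by (simp only: hist_supported)
      then have "hist t c (inv h \<otimes> g) = 0" using False h g by (simp add: coset_part_def)
      then show ?thesis by simp
    qed
    have "coset_part J (a \<diamondop> hist t c) g =
        (\<Sum>h\<in>carrier G. if coset g = J then a h * hist t c (inv h \<otimes> g) else 0)"
      using g by (simp add: coset_part_def conv_apply)
    also have "\<dots> = (a' \<diamondop> hist t c) g"
      unfolding conv_apply[OF g] by (intro sum.cong refl mult)
    finally show "coset_part J (a \<diamondop> hist t c) g = (a' \<diamondop> hist t c) g" .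
  qed (simp_all add: a'_def add_multiple.hyps)
  moreover have "coset_part J (x \<oplus>\<^bsub>group_algebra G\<^esub> y) =
      coset_part J x \<oplus>\<^bsub>group_algebra G\<^esub> coset_part J y" for y
    by (auto simp: coset_part_def group_algebra_simps)
  ultimately show ?case
    using hist_ideal.add_multiple[OF add_multiple.IH, of a' t c] by (simp add: a'_def)
qed

text \<open>The parts of \<open>hist t c \<cdot> w\<close> in the various cosets are, up to normalization, the histories extended by
  these cosets.\<close>

lemma hist_ideal_step:
  assumes "x \<in> hist_ideal"
  shows "x \<diamondop> step \<in> hist_ideal"
  using assms
proof (induction rule: hist_ideal.induct)
  case zero
  then show ?case by (simp add: hist_ideal.zero)
next
  case (add_multiple x a t c)
  have "hist t c \<diamondop> step \<in> hist_ideal"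
  proof (rule hist_ideal_of_coset_parts)
    fix K
    let ?c = "c(Suc t := K)"
    have "hist t ?c = hist t c" by (rule hist_cong) simp
    then have "coset_part K (hist t c \<diamondop> step) = smult total_weight (hist (Suc t) ?c)"
      using total_weight_pos by (intro galg_ext) (simp_all add: hist_Suc coset_part_def smult_def)
    also have "\<dots> = smult total_weight (point \<one>) \<diamondop> hist (Suc t) ?c" by (rule smult_eq_conv) simp
    also have "\<dots> \<in> hist_ideal" by (rule multiple_in_hist_ideal) simp
    finally show "coset_part K (hist t c \<diamondop> step) \<in> hist_ideal" .
  qed simp
  then have "x \<diamondop> step \<oplus>\<^bsub>group_algebra G\<^esub> a \<diamondop> (hist t c \<diamondop> step) \<in> hist_ideal"
    by (rule hist_ideal_add[OF hist_ideal_left[OF _ add_multiple.hyps(2)] add_multiple.IH])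
  then show ?case using add_multiple.hyps by (simp add: hist_ideal_closed galg.l_distr galg.m_assoc)
qed

lemma initial_in_hist_ideal: "galg_of G \<alpha> \<in> hist_ideal"
proof (rule hist_ideal_of_coset_parts)
  fix K show "coset_part K (galg_of G \<alpha>) \<in> hist_ideal"
    using hist_in_hist_ideal[of 0 "\<lambda>_. K"] by (simp add: hist_0)
qed simp

lemma hist_ideal_balance:
  assumes "lumps_weakly G H M X" "x \<in> hist_ideal"
  shows "x \<diamondop> step \<diamondop> avg = x \<diamondop> avg \<diamondop> step \<diamondop> avg"
  using assms(2)
proof (induction rule: hist_ideal.induct)
  case zero
  show ?case by simp
next
  case (add_multiple x a t c)
  have "hist t c \<diamondop> (step \<diamondop> avg) = hist t c \<diamondop> (avg \<diamondop> (step \<diamondop> avg))"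
    using assms(1) unfolding lumps_weakly_iff by (simp add: galg.m_assoc)
  then show ?case
    using add_multiple by (simp add: hist_ideal_closed galg.l_distr galg.m_assoc)
qed

lemma admissible_if_lumps_weakly:
  assumes "lumps_weakly G H M X"
  shows "\<exists>e\<in>E_bullet G H. admissible e"
proof -
  obtain e where eL: "e \<in> hist_ideal" and eH: "e \<in> galg_sub G H"
    and right: "\<And>x. x \<in> hist_ideal \<Longrightarrow> x \<diamondop> e = x"
  proof (rule left_ideal_idempotent[of hist_ideal])
    show "hist_ideal \<subseteq> carrier (group_algebra G)" using hist_ideal_closed by blast
    show "hist_ideal \<noteq> {}" using hist_ideal.zero by blast
  qed (use hist_ideal_add hist_ideal_left hist_ideal_coset_part in blast)+
  \<comment> \<open>As \<open>\<alpha> e = \<alpha>\<close> and \<open>\<alpha>\<close> has mass 1, so has \<open>e\<close>; this is what \<open>\<eta> e = \<eta>\<close> asks for.\<close>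
  have "aug (galg_of G \<alpha>) = of_real (\<Sum>g\<in>carrier G. \<alpha> g)"
    unfolding aug_def of_real_sum by (intro sum.cong) (simp_all add: galg_of_def)
  also have "(\<Sum>g\<in>carrier G. \<alpha> g) = 1" using init by (simp add: prob_distribution_def)
  finally have aug_e: "aug e = 1"
    using aug_conv[of "galg_of G \<alpha>" e] right[OF initial_in_hist_ideal] by simp
  have eA: "e \<in> carrier (group_algebra G)" using eL by (rule hist_ideal_closed)
  have eE: "e \<in> E_bullet G H"
    using eH right[OF eL] eta_conv[OF eH aug_e] by (simp add: E_bullet_iff)
  moreover have "admissible e"
    unfolding admissible_iff[OF eE]
    using right[OF initial_in_hist_ideal] right[OF hist_ideal_step[OF eL]]
      hist_ideal_balance[OF assms eL] by (simp add: conv_eta[OF eH aug_e])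
  ultimately show ?thesis by blast
qed

end

section \<open>The characterization\<close>

theorem theorem1p2:
  fixes G :: "('a, 'm) monoid_scheme" (structure)
    and H :: "'a set"
    and w \<alpha> :: "'a \<Rightarrow> real"
    and M :: "'b measure"
    and X :: "nat \<Rightarrow> 'b \<Rightarrow> 'a"
  assumes "group G" and "finite (carrier G)"
    and "subgroup H G"
    and "irreducible_weight G w"
    and "prob_distribution G \<alpha>"
    and "is_MC G \<alpha> w M X"
  shows
    "(lumps_weakly G H M X \<longleftrightarrow>
       (\<exists>e \<in> E_bullet G H.
          galg_of G \<alpha> \<in> PIdl\<^bsub>group_algebra G\<^esub> e \<and>
          e \<otimes>\<^bsub>group_algebra G\<^esub> galg_of G w \<otimes>\<^bsub>group_algebra G\<^esub>
            (\<one>\<^bsub>group_algebra G\<^esub> \<ominus>\<^bsub>group_algebra G\<^esub> e) = \<zero>\<^bsub>group_algebra G\<^esub> \<and>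
          (e \<ominus>\<^bsub>group_algebra G\<^esub> eta G H) \<otimes>\<^bsub>group_algebra G\<^esub> galg_of G w
            \<otimes>\<^bsub>group_algebra G\<^esub> eta G H = \<zero>\<^bsub>group_algebra G\<^esub>))
     \<and>
     (\<forall>e \<in> E_bullet G H.
        galg_of G \<alpha> \<in> PIdl\<^bsub>group_algebra G\<^esub> e \<and>
        e \<otimes>\<^bsub>group_algebra G\<^esub> galg_of G w \<otimes>\<^bsub>group_algebra G\<^esub>
          (\<one>\<^bsub>group_algebra G\<^esub> \<ominus>\<^bsub>group_algebra G\<^esub> e) = \<zero>\<^bsub>group_algebra G\<^esub> \<and>
        (e \<ominus>\<^bsub>group_algebra G\<^esub> eta G H) \<otimes>\<^bsub>group_algebra G\<^esub> galg_of G w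
          \<otimes>\<^bsub>group_algebra G\<^esub> eta G H = \<zero>\<^bsub>group_algebra G\<^esub>
        \<longrightarrow>
        (\<forall>t c. \<P>(\<omega> in M. \<forall>i\<le>t. X i \<omega> <# H = c i) > 0 \<longrightarrow>
           galg_of G (cond_dist G H M X t c) \<in> PIdl\<^bsub>group_algebra G\<^esub> e))"
proof -
  interpret group G by fact
  interpret walk_on_cosets G H w \<alpha> M X
    by (intro walk_on_cosets.intro finite_group_subgroup.intro finite_group_subgroup_axioms.intro
        walk_on_cosets_axioms.intro assms)
  have "lumps_weakly G H M X \<longleftrightarrow> (\<exists>e\<in>E_bullet G H. admissible e)"
    using admissible_if_lumps_weakly lumps_weakly_if_admissible by blast
  moreover have "\<forall>e\<in>E_bullet G H. admissible e \<longrightarrow>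
      (\<forall>t c. \<P>(\<omega> in M. \<forall>i\<le>t. X i \<omega> <# H = c i) > 0 \<longrightarrow>
         galg_of G (cond_dist G H M X t c) \<in> PIdl\<^bsub>group_algebra G\<^esub> e)"
    using cond_dist_in_ideal by blast
  ultimately show ?thesis unfolding admissible_def by (rule conjI)
qed

end
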